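(* Assume $\rho + \delta -(1-\gamma)\left(r + \delta +\frac{\kappa^\top \kappa}{2\gamma }\right) >0$. Set $b=1-\frac1\gamma$ and $$\nu:=\frac{\gamma}{\rho+\delta-(1-\gamma)(r+\delta+\frac{\kappa^\top\kappa}{2\gamma})},\qquad \eta:=(1+\delta k^{-b})\nu,\qquad \hat\eta:=(K^{-b}+\delta k^{-b})\nu,$$ $$f(t):=(\hat\eta-\eta)\exp\Big(-\frac{\tau_R-t}{\nu}\Big)+\eta,\qquad F(t):=e^{-\frac{(\rho+\delta)t}{\gamma}}f(t),\qquad t\in[0,\tau_R].$$ Then the function $$\overline v(t,w,x):=F(t)^\gamma\,\frac{\Gamma(t,w,x)^{1-\gamma}}{1-\gamma},\qquad (t,w,x)\in\mathcal H_{++}^{0,\tau_R},$$ is a classical solution of the HJB equation $$-\partial_tv(t,w,x)=\mathbb H^{fh}\big(t,(w,x),\nabla v(t,w,x),\nabla^2v(t,w,x)\big),\qquad v(\tau_R,w,x)=e^{-(\rho+\delta)\tau_R}\,\hat\eta^{\gamma}\,\frac{w^{1-\gamma}}{1-\gamma}.$$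
   Context: Parameters: $r\in\mathbb R$, $\mu\in\mathbb R^n$, $\sigma\in\mathbb R^{n\times n}$ invertible, $\delta>0$, $\rho>0$, $K>1$, $k>0$, $\gamma\in(0,1)\cup(1,\infty)$, $\tau_R>0$, $d>0$, $\mu_y\in\mathbb R$, $\sigma_y\in\mathbb R^n$, $\phi\in L^2(-d,0;\mathbb R)$; $\mathbf 1=(1,\dots,1)^\top\in\mathbb R^n$; $\kappa:=\sigma^{-1}(\mu-r\mathbf 1)$; $\beta:=r+\delta-\mu_y+\sigma_y^\top\kappa$, with the standing assumption $\beta>0$. $M_2:=\mathbb R\times L^2(-d,0;\mathbb R)$ with inner product $\langle(x_0,x_1),(z_0,z_1)\rangle_{M_2}=x_0z_0+\langle x_1,z_1\rangle$, $\langle\cdot,\cdot\rangle$ being the $L^2(-d,0)$ inner product; $\mathcal H:=\mathbb R\times M_2$. The operator $A^*$ (adjoint of $A(x_0,x_1)=(\mu_yx_0+\langle\phi,x_1\rangle,x_1')$ with $\mathcal D(A)=\{x_1\in W^{1,2},\ x_0=x_1(0)\}$) is $$\mathcal D(A^* )=\{(z_0,z_1)\in M_2:\ z_1\in W^{1,2}(-d,0;\mathbb R),\ z_1(-d)=0\},\qquad A^*(z_0,z_1)=(\mu_yz_0+z_1(0),\,-z_1'+z_0\phi).$$ $(g,h)$, with $g:[0,\infty)\to\mathbb R$ and $h:[0,\infty)\times[-d,0]\to\mathbb R$ continuous, is the unique continuous solution of $$g(t)=\mathbb I_{\{t<\tau_R\}}\int_t^{\tau_R}e^{-\beta(\tau-t)}(h(\tau,0)+1)\,\mathrm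 d\tau,\qquad h(t,\zeta)=\mathbb I_{\{t<\tau_R\}}\int_{(\zeta+t-\tau_R)\vee(-d)}^{\zeta}e^{-(r+\delta)(\zeta-\tau)}g(t+\zeta-\tau)\phi(\tau)\,\mathrm d\tau;$$ $h(t):=h(t,\cdot)$; $\Gamma(t,w,x):=w+g(t)x_0+\langle h(t),x_1\rangle$; $\mathcal H_{++}^{0,\tau_R}:=\{(t,w,x)\in[0,\tau_R]\times\mathcal H:\ \Gamma(t,w,x)>0\}$. Hamiltonian: with $p=(p_0,p_1)\in\mathbb R\times\mathcal D(A^* )$ (in the HJB equation $p_0=\partial_wv$, $p_1=\partial_xv$) and second-order entries $P_{11}=\partial^2_{ww}v$, $P_{12}=\partial^2_{wx_0}v$, $P_{22}=\partial^2_{x_0x_0}v$, $$\mathbb H^{fh}(t,(w,x),p,P)=(r+\delta)wp_0+x_0p_0+\langle x,A^*p_1\rangle_{M_2}+\tfrac12\sigma_y^\top\sigma_yx_0^2P_{22}+\mathbb H^{fh}_{\max}(t,x_0,p_0,P_{11},P_{12}),$$ $$\mathbb H^{fh}_{\max}(t,x_0,p_0,P_{11},P_{12})=\sup_{(c,B,\theta)\in\mathbb R_+^2\times\mathbb R^n}\Big\{e^{-(\rho+\delta)t}\Big(\tfrac{c^{1-\gamma}}{1-\gamma}+\delta\tfrac{k^{1-\gamma}B^{1-\gamma}}{1-\gamma}\Big)+[\theta^\top(\mu-r\mathbf 1)-c-\delta B]p_0+\tfrac12\theta^\top\sigma\sigma^\top\theta P_{11}+\theta^\top\sigma\sigma_yx_0P_{12}\Big\}.$$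 A function $v:\mathcal H_{++}^{0,\tau_R}\to\mathbb R$ is a classical solution of the HJB equation if: (1) $v$ is continuously Fréchet differentiable and its second Fréchet derivatives with respect to the couple $(w,x_0)$ exist and are continuous in $\mathcal H_{++}^{0,\tau_R}$; (2) $\partial_xv(t,w,x)\in\mathcal D(A^* )$ for all $(t,w,x)\in\mathcal H_{++}^{0,\tau_R}$ and $A^*\partial_xv$ is continuous in $\mathcal H_{++}^{0,\tau_R}$; (3) $v$ satisfies the HJB equation (with its terminal condition) for every $(t,w,x)\in\mathcal H_{++}^{0,\tau_R}$. Derivatives in $t$ at the endpoints $0,\tau_R$ are one-sided. *)

theory Defs
  imports "HOL-Analysis.Analysis"
begin

section \<open>Square-integrable functions modulo null sets\<close>

definition sq_integrable :: "(real \<Rightarrow> real) \<Rightarrow> bool" where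
  "sq_integrable f \<longleftrightarrow> f \<in> borel_measurable lborel \<and> integrable lborel (\<lambda>x. (f x)\<^sup>2)"

lemma sq_integrable_mult:
  assumes "sq_integrable f" "sq_integrable g"
  shows "integrable lborel (\<lambda>x. f x * g x)"
proof (rule Bochner_Integration.integrable_bound)
  show "integrable lborel (\<lambda>x. (f x)\<^sup>2 + (g x)\<^sup>2)"
    using assms by (auto simp: sq_integrable_def)
  show "(\<lambda>x. f x * g x) \<in> borel_measurable lborel"
    using assms by (auto simp: sq_integrable_def)
  have "\<bar>a * b\<bar> \<le> a\<^sup>2 + b\<^sup>2" for a b :: real
  proof -
    have "2 * (\<bar>a\<bar> * \<bar>b\<bar>) \<le> a\<^sup>2 + b\<^sup>2"
      using zero_le_power2[of "\<bar>a\<bar> - \<bar>b\<bar>"] by (simp add: power2_diff)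
    moreover have "0 \<le> \<bar>a\<bar> * \<bar>b\<bar>" by simp
    ultimately show ?thesis unfolding abs_mult by linarith
  qed
  then show "AE x in lborel. norm (f x * g x) \<le> norm ((f x)\<^sup>2 + (g x)\<^sup>2)"
    by simp
qed

lemma sq_integrable_add:
  assumes "sq_integrable f" "sq_integrable g"
  shows "sq_integrable (\<lambda>x. f x + g x)"
  using assms sq_integrable_mult[OF assms]
  by (auto simp: sq_integrable_def power2_sum mult.assoc)

lemma sq_integrable_scale: "sq_integrable f \<Longrightarrow> sq_integrable (\<lambda>x. c * f x)"
  by (auto simp: sq_integrable_def power_mult_distrib)

lemma sq_integrable_minus: "sq_integrable f \<Longrightarrow> sq_integrable (\<lambda>x. - f x)"
  by (auto simp: sq_integrable_def)

lemma sq_integrable_diff: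
  assumes "sq_integrable f" "sq_integrable g"
  shows "sq_integrable (\<lambda>x. f x - g x)"
  using sq_integrable_add[OF assms(1) sq_integrable_minus[OF assms(2)]] by simp

lemma sq_integrable_zero: "sq_integrable (\<lambda>x. 0)"
  by (simp add: sq_integrable_def)

quotient_type L2fun = "real \<Rightarrow> real" /
  partial: "\<lambda>f g. sq_integrable f \<and> sq_integrable g \<and> (AE x in lborel. f x = g x)"
proof (rule part_equivpI)
  show "\<exists>f. sq_integrable f \<and> sq_integrable f \<and> (AE x in lborel. f x = f x)"
    using sq_integrable_zero by auto
qed (auto intro!: sympI transpI elim: AE_mp)

instantiation L2fun :: real_inner
begin

lift_definition zero_L2fun :: L2fun is "\<lambda>x. 0"
  by (simp add: sq_integrable_zero)

lift_definition plus_L2fun :: "L2fun \<Rightarrow> L2fun \<Rightarrow> L2fun" is "\<lambda>f g x. f x + g x"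
  by (auto simp: sq_integrable_add)

lift_definition minus_L2fun :: "L2fun \<Rightarrow> L2fun \<Rightarrow> L2fun" is "\<lambda>f g x. f x - g x"
  by (auto simp: sq_integrable_diff)

lift_definition uminus_L2fun :: "L2fun \<Rightarrow> L2fun" is "\<lambda>f x. - f x"
  by (auto simp: sq_integrable_minus)

lift_definition scaleR_L2fun :: "real \<Rightarrow> L2fun \<Rightarrow> L2fun" is "\<lambda>c f x. c * f x"
  by (auto simp: sq_integrable_scale)

lift_definition inner_L2fun :: "L2fun \<Rightarrow> L2fun \<Rightarrow> real" is "\<lambda>f g. LBINT x. f x * g x"
proof -
  fix f f' g g' :: "real \<Rightarrow> real"
  assume "sq_integrable f \<and> sq_integrable f' \<and> (AE x in lborel. f x = f' x)"
    and "sq_integrable g \<and> sq_integrable g' \<and> (AE x in lborel. g x = g' x)"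
  then show "(LBINT x. f x * g x) = (LBINT x. f' x * g' x)"
    by (intro integral_cong_AE) (auto simp: sq_integrable_def)
qed

definition norm_L2fun :: "L2fun \<Rightarrow> real" where "norm_L2fun u = sqrt (inner u u)"
definition dist_L2fun :: "L2fun \<Rightarrow> L2fun \<Rightarrow> real" where "dist_L2fun u v = norm (u - v)"
definition sgn_L2fun :: "L2fun \<Rightarrow> L2fun" where "sgn_L2fun u = inverse (norm u) *\<^sub>R u"
definition uniformity_L2fun :: "(L2fun \<times> L2fun) filter" where
  "uniformity_L2fun = (INF e\<in>{0<..}. principal {(x, y). dist x y < e})"
definition open_L2fun :: "L2fun set \<Rightarrow> bool" where
  "open_L2fun U = (\<forall>x\<in>U. \<forall>\<^sub>F (x', y) in uniformity. x' = x \<longrightarrow> y \<in> U)"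

instance
proof
  fix u v w :: L2fun and a b :: real
  show "u + v + w = u + (v + w)"
    by transfer (auto simp: sq_integrable_add add.assoc)
  show "u + v = v + u"
    by transfer (auto simp: sq_integrable_add add.commute)
  show "0 + u = u"
    by transfer auto
  show "- u + u = 0"
    by transfer (auto simp: sq_integrable_zero)
  show "u - v = u + - v"
    by transfer (auto simp: sq_integrable_diff)
  show "a *\<^sub>R (u + v) = a *\<^sub>R u + a *\<^sub>R v"
    by transfer (auto simp: sq_integrable_add sq_integrable_scale algebra_simps)
  show "(a + b) *\<^sub>R u = a *\<^sub>R u + b *\<^sub>R u"
    by transfer
      (simp add: sq_integrable_add sq_integrable_scale distrib_right)
  show "a *\<^sub>R b *\<^sub>R u = (a * b) *\<^sub>R u"
    by transfer (auto simp: sq_integrable_scale mult.assoc)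
  show "1 *\<^sub>R u = u"
    by transfer auto
  show "dist u v = norm (u - v)"
    by (rule dist_L2fun_def)
  show "sgn u = inverse (norm u) *\<^sub>R u"
    by (rule sgn_L2fun_def)
  show "uniformity = (INF e\<in>{0<..}. principal {(x :: L2fun, y). dist x y < e})"
    by (rule uniformity_L2fun_def)
  show "open U = (\<forall>x\<in>U. \<forall>\<^sub>F (x', y) in uniformity. x' = x \<longrightarrow> y \<in> U)" for U :: "L2fun set"
    by (rule open_L2fun_def)
  show "inner u v = inner v u"
    by transfer (simp add: mult.commute)
  show "inner (u + v) w = inner u w + inner v w"
    by transfer (simp add: distrib_right sq_integrable_mult)
  show "inner (a *\<^sub>R u) v = a * inner u v"
    by transfer (simp add: mult.assoc)
  show "0 \<le> inner u u"
    by transfer simp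
  show "inner u u = 0 \<longleftrightarrow> u = 0"
  proof transfer
    fix f :: "real \<Rightarrow> real"
    assume f: "sq_integrable f \<and> sq_integrable f \<and> (AE x in lborel. f x = f x)"
    then have "integrable lborel (\<lambda>x. f x * f x)"
      by (simp add: sq_integrable_mult)
    then have "(LBINT x. f x * f x) = 0 \<longleftrightarrow> (AE x in lborel. f x * f x = 0)"
      by (intro integral_nonneg_eq_0_iff_AE) auto
    then show "(LBINT x. f x * f x) = 0 \<longleftrightarrow>
        sq_integrable f \<and> sq_integrable (\<lambda>x. 0) \<and> (AE x in lborel. f x = 0)"
      using f by (simp add: sq_integrable_zero)
  qed
  show "norm u = sqrt (inner u u)"
    by (rule norm_L2fun_def)
qed

end

section \<open>The spaces of the delay problem\<close>

text \<open>
  The space \<open>L\<^sup>2(-d,0)\<close> is identified with the closed subspace of \<open>L\<^sup>2(\<real>)\<close> of the classes that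
  vanish almost everywhere outside \<open>(-d,0)\<close> (extension by zero is an isometry).  This keeps \<open>d\<close> a
  term-level parameter.  The inner products of \<open>M\<^sub>2\<close> and of \<open>\<H> = \<real> \<times> M\<^sub>2\<close> are then those of the
  product types.  Points of \<open>[0,\<tau>\<^sub>R] \<times> \<H>\<close> are tuples \<open>(t, w, x\<^sub>0, x\<^sub>1)\<close>.
\<close>

definition L2 :: "real \<Rightarrow> L2fun set" where
  "L2 d = {u. AE s in lborel. s \<notin> {-d<..<0} \<longrightarrow> rep_L2fun u s = 0}"

definition M2 :: "real \<Rightarrow> (real \<times> L2fun) set" where
  "M2 d = UNIV \<times> L2 d"

definition to_L2 :: "real \<Rightarrow> (real \<Rightarrow> real) \<Rightarrow> L2fun" where
  "to_L2 d f = abs_L2fun (\<lambda>s. indicat_real {-d<..<0} s * f s)"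

definition test_function :: "real \<Rightarrow> (real \<Rightarrow> real) \<Rightarrow> bool" where
  "test_function d \<psi> \<longleftrightarrow> \<psi> C1_differentiable_on UNIV \<and> closure {s. \<psi> s \<noteq> 0} \<subseteq> {-d<..<0}"

definition weak_deriv :: "real \<Rightarrow> L2fun \<Rightarrow> L2fun \<Rightarrow> bool" where
  "weak_deriv d u u' \<longleftrightarrow>
    (\<forall>\<psi>. test_function d \<psi> \<longrightarrow>
      (LBINT s:{-d<..<0}. rep_L2fun u s * deriv \<psi> s) =
      - (LBINT s:{-d<..<0}. rep_L2fun u' s * \<psi> s))"

definition W12 :: "real \<Rightarrow> L2fun set" where
  "W12 d = {u \<in> L2 d. \<exists>u'\<in>L2 d. weak_deriv d u u'}"

definition wderiv :: "real \<Rightarrow> L2fun \<Rightarrow> L2fun" where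
  "wderiv d u = (THE u'. u' \<in> L2 d \<and> weak_deriv d u u')"

text \<open>
  Point values, including those at the endpoints, are the values of the representative that is
  continuous on \<open>[-d,0]\<close>; for \<open>u \<in> W12 d\<close> it exists, and it is unique.
\<close>

definition cont_value :: "real \<Rightarrow> L2fun \<Rightarrow> real \<Rightarrow> real" where
  "cont_value d u s = (THE y. \<exists>f. continuous_on {-d..0} f \<and>
     (AE \<xi> in lborel. \<xi> \<in> {-d<..<0} \<longrightarrow> rep_L2fun u \<xi> = f \<xi>) \<and> f s = y)"

definition dom_Astar :: "real \<Rightarrow> (real \<times> L2fun) set" where
  "dom_Astar d = {(z0, z1). z1 \<in> W12 d \<and> cont_value d z1 (- d) = 0}"

definition Astar :: "real \<Rightarrow> real \<Rightarrow> L2fun \<Rightarrow> real \<times> L2fun \<Rightarrow> real \<times> L2fun" where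
  "Astar d \<mu>y \<phi> z =
    (case z of (z0, z1) \<Rightarrow> (\<mu>y * z0 + cont_value d z1 0, - wderiv d z1 + z0 *\<^sub>R \<phi>))"

definition gh_solution ::
    "real \<Rightarrow> real \<Rightarrow> real \<Rightarrow> real \<Rightarrow> L2fun \<Rightarrow> real \<Rightarrow> (real \<Rightarrow> real) \<Rightarrow> (real \<Rightarrow> real \<Rightarrow> real) \<Rightarrow> bool"
  where
  "gh_solution r \<delta> \<beta> d \<phi> \<tau>R g h \<longleftrightarrow>
    continuous_on {0..} g \<and>
    continuous_on ({0..} \<times> {-d..0}) (\<lambda>(t, \<zeta>). h t \<zeta>) \<and>
    (\<forall>t\<ge>0. g t = (if t < \<tau>R
        then LBINT \<tau>:{t..\<tau>R}. exp (- \<beta> * (\<tau> - t)) * (h \<tau> 0 + 1) else 0)) \<and>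
    (\<forall>t\<ge>0. \<forall>\<zeta>\<in>{-d..0}. h t \<zeta> = (if t < \<tau>R
        then LBINT \<tau>:{max (\<zeta> + t - \<tau>R) (- d)..\<zeta>}.
               exp (- (r + \<delta>) * (\<zeta> - \<tau>)) * g (t + \<zeta> - \<tau>) * rep_L2fun \<phi> \<tau>
        else 0))"

definition Gam ::
    "real \<Rightarrow> (real \<Rightarrow> real) \<Rightarrow> (real \<Rightarrow> real \<Rightarrow> real) \<Rightarrow> real \<times> real \<times> real \<times> L2fun \<Rightarrow> real" where
  "Gam d g h = (\<lambda>(t, w, x0, x1). w + g t * x0 + inner (to_L2 d (h t)) x1)"

definition Hpp ::
    "real \<Rightarrow> real \<Rightarrow> (real \<Rightarrow> real) \<Rightarrow> (real \<Rightarrow> real \<Rightarrow> real) \<Rightarrow> (real \<times> real \<times> real \<times> L2fun) set"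
  where
  "Hpp d \<tau>R g h = {(t, w, x). t \<in> {0..\<tau>R} \<and> x \<in> M2 d \<and> 0 < Gam d g h (t, w, x)}"

section \<open>The Hamiltonian\<close>

text \<open>
  The supremum may be \<open>+\<infinity>\<close>, and for \<open>\<gamma> > 1\<close> the utility of zero consumption is \<open>-\<infinity>\<close> (whereas
  \<open>0 powr (1 - \<gamma>) = 0\<close>), hence extended reals.
\<close>

definition crra :: "real \<Rightarrow> real \<Rightarrow> ereal" where
  "crra \<gamma> c = (if c = 0 \<and> \<gamma> > 1 then - \<infinity> else ereal (c powr (1 - \<gamma>) / (1 - \<gamma>)))"

definition Ham_max ::
    "real \<Rightarrow> real^'n \<Rightarrow> real^'n^'n \<Rightarrow> real^'n \<Rightarrow> real \<Rightarrow> real \<Rightarrow> real \<Rightarrow> real \<Rightarrow>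
     real \<Rightarrow> real \<Rightarrow> real \<Rightarrow> real \<Rightarrow> real \<Rightarrow> ereal" where
  "Ham_max r \<mu> \<sigma> \<sigma>y \<delta> \<rho> k \<gamma> t x0 p0 P11 P12 =
    (SUP (c, B, \<theta>) \<in> {0..} \<times> {0..} \<times> UNIV.
       ereal (exp (- (\<rho> + \<delta>) * t)) * (crra \<gamma> c + ereal (\<delta> * k powr (1 - \<gamma>)) * crra \<gamma> B)
       + ereal ((inner \<theta> (\<mu> - r *\<^sub>R (\<chi> i. 1)) - c - \<delta> * B) * p0
                + 1 / 2 * inner \<theta> ((\<sigma> ** transpose \<sigma>) *v \<theta>) * P11
                + inner \<theta> (\<sigma> *v \<sigma>y) * x0 * P12))"

definition Ham ::
    "real \<Rightarrow> real^'n \<Rightarrow> real^'n^'n \<Rightarrow> real \<Rightarrow> real^'n \<Rightarrow> real \<Rightarrow> real \<Rightarrow> real \<Rightarrow> real \<Rightarrow> real \<Rightarrow> L2fun \<Rightarrow>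
     real \<times> real \<times> real \<times> L2fun \<Rightarrow> real \<times> (real \<times> L2fun) \<Rightarrow> real \<times> real \<times> real \<Rightarrow> ereal" where
  "Ham r \<mu> \<sigma> \<mu>y \<sigma>y \<delta> \<rho> k \<gamma> d \<phi> = (\<lambda>(t, w, x) (p0, p1) (P11, P12, P22).
     ereal ((r + \<delta>) * w * p0 + fst x * p0 + inner x (Astar d \<mu>y \<phi> p1)
            + 1 / 2 * inner \<sigma>y \<sigma>y * (fst x)\<^sup>2 * P22)
     + Ham_max r \<mu> \<sigma> \<sigma>y \<delta> \<rho> k \<gamma> t (fst x) p0 P11 P12)"

section \<open>Classical solutions\<close>

text \<open>
  \<open>U\<close> is the domain, \<open>AA\<close> the operator \<open>A\<^sup>*\<close>, \<open>HH\<close> the Hamiltonian and \<open>vT\<close> the terminal datum.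
  The functions \<open>vt\<close>, \<open>vw\<close>, \<open>vx\<close> are the partial derivatives, the last one a gradient in \<open>M\<^sub>2\<close>
  (by Riesz representation), so their continuity is continuity of the Frechet derivative.
  As \<open>U\<close> is contained in \<open>[0,\<tau>\<^sub>R] \<times> \<H>\<close>, differentiation within \<open>U\<close> is
  differentiation along \<open>\<H>\<close> only, and one-sided in time at \<open>0\<close> and \<open>\<tau>\<^sub>R\<close>.
  The second derivative in \<open>(w, x\<^sub>0)\<close> is the derivative of the gradient in \<open>(w, x\<^sub>0)\<close> with
  \<open>t\<close> and \<open>x\<^sub>1\<close> frozen; \<open>(vww, vwx, vxx)\<close> are the entries of the (symmetric) Hessian.
\<close>

definition classical_solution ::
    "real \<Rightarrow> (real \<times> L2fun \<Rightarrow> real \<times> L2fun) \<Rightarrow> real \<Rightarrow> (real \<times> real \<times> real \<times> L2fun) set \<Rightarrow>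
     (real \<times> real \<times> real \<times> L2fun \<Rightarrow> real \<times> (real \<times> L2fun) \<Rightarrow> real \<times> real \<times> real \<Rightarrow> ereal) \<Rightarrow>
     (real \<times> real \<times> L2fun \<Rightarrow> real) \<Rightarrow>
     (real \<times> real \<times> real \<times> L2fun \<Rightarrow> real) \<Rightarrow> bool" where
  "classical_solution d AA \<tau>R U HH vT v \<longleftrightarrow>
    (\<exists>vt vw vx vww vwx vxx.
      (\<forall>p\<in>U. vx p \<in> M2 d \<and>
        (v has_derivative (\<lambda>(s, \<omega>, \<xi>). vt p * s + vw p * \<omega> + inner (vx p) \<xi>)) (at p within U)) \<and>
      continuous_on U vt \<and> continuous_on U vw \<and> continuous_on U vx \<and>
      (\<forall>(t, w, x0, x1)\<in>U.
        ((\<lambda>(w', x0'). (vw (t, w', x0', x1), fst (vx (t, w', x0', x1)))) has_derivative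
         (\<lambda>(\<omega>, \<xi>0). (vww (t, w, x0, x1) * \<omega> + vwx (t, w, x0, x1) * \<xi>0,
                      vwx (t, w, x0, x1) * \<omega> + vxx (t, w, x0, x1) * \<xi>0)))
        (at (w, x0) within {(w', x0'). (t, w', x0', x1) \<in> U})) \<and>
      continuous_on U vww \<and> continuous_on U vwx \<and> continuous_on U vxx \<and>
      (\<forall>p\<in>U. vx p \<in> dom_Astar d) \<and> continuous_on U (\<lambda>p. AA (vx p)) \<and>
      (\<forall>p\<in>U. ereal (- vt p) = HH p (vw p, vx p) (vww p, vwx p, vxx p)) \<and>
      (\<forall>w x. (\<tau>R, w, x) \<in> U \<longrightarrow> v (\<tau>R, w, x) = vT (w, x)))"

end

theory Submission
  imports Defs
begin

text \<open>
  The pair \<open>(g, h)\<close> is built so that \<open>\<Gamma>\<close> linearizes the state equation: \<open>g\<close> satisfies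
  \<open>g' = \<beta> g - h(\<cdot>, 0) - 1\<close> on \<open>[0, \<tau>\<^sub>R]\<close>, and \<open>h\<close> solves the transport equation
  \<open>\<partial>\<^sub>t h - \<partial>\<^sub>\<zeta> h = (r + \<delta>) h - g \<phi>\<close>. Hence in \<open>\<partial>\<^sub>t \<Gamma> + \<langle>x, A\<^sup>* \<partial>\<^sub>x \<Gamma>\<rangle>\<close> the unbounded terms
  cancel, and with the income term \<open>x\<^sub>0\<close> what remains is
  \<open>(r + \<delta>) (\<Gamma> - w) + (\<sigma>\<^sub>y \<bullet> \<kappa>) g x\<^sub>0\<close>. The Hamiltonian is maximized at \<open>c = \<Gamma> / f\<close>,
  \<open>B = k powr (- b) * c\<close> and \<open>\<sigma>\<^sup>T \<theta> = (\<Gamma> / \<gamma>) \<kappa> - g x\<^sub>0 \<sigma>\<^sub>y\<close>, after which the equation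
  reduces to \<open>f' = f / \<nu> - (1 + \<delta> k powr (- b))\<close>.

  Since \<open>\<phi>\<close> is only square integrable, both derivatives of \<open>h\<close> are taken in \<open>L\<^sup>2\<close>. On the whole line
  \<open>h(t, \<cdot>)\<close> is the convolution of \<open>\<phi>\<close> with \<open>s \<mapsto> exp (- (r + \<delta>) s) g(t + s)\<close>, which vanishes
  for \<open>s < 0\<close> and \<open>s > \<tau>\<^sub>R - t\<close>: Fubini and partial integration against test functions give the
  weak \<open>\<zeta>\<close>-derivative, and dominated convergence (the kink of \<open>g\<close> at \<open>\<tau>\<^sub>R\<close> affects a single point)
  gives the \<open>t\<close>-derivative.
\<close>

section \<open>Classes of functions on the delay interval\<close>

lemma rep_abs_L2fun:
  assumes "sq_integrable f"
  shows "sq_integrable (rep_L2fun (abs_L2fun f))" "AE x in lborel. rep_L2fun (abs_L2fun f) x = f x"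
  using Quotient3_rep_abs[OF Quotient3_L2fun, of f] assms by auto

lemma sq_integrable_rep: "sq_integrable (rep_L2fun u)"
  using Quotient3_rep_reflp[OF Quotient3_L2fun, of u] by auto

lemma abs_L2fun_eq:
  assumes "sq_integrable f" "sq_integrable g" "AE x in lborel. f x = g x"
  shows "abs_L2fun f = abs_L2fun g"
  using assms Quotient3_rel_abs[OF Quotient3_L2fun, of f g] by auto

lemma L2fun_eqI:
  assumes "AE x in lborel. rep_L2fun u x = rep_L2fun v x"
  shows "u = v"
proof -
  have "abs_L2fun (rep_L2fun u) = abs_L2fun (rep_L2fun v)"
    using assms by (intro abs_L2fun_eq sq_integrable_rep)
  then show ?thesis
    by (simp add: Quotient3_abs_rep[OF Quotient3_L2fun])
qed

text \<open>This is the integrand inside \<open>to_L2\<close>. As a genuine function on the whole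
  line it allows linearity, measurability and integrability to be settled before passing to
  classes.\<close>

definition restr :: "real \<Rightarrow> (real \<Rightarrow> real) \<Rightarrow> real \<Rightarrow> real" where
  "restr d f s = indicat_real {-d<..<0} s * f s"

lemma to_L2_eq: "to_L2 d f = abs_L2fun (restr d f)"
  by (simp add: to_L2_def restr_def[abs_def])

lemma integrable_indicator_interval:
  fixes a b :: real
  shows "integrable lborel (indicat_real {a<..<b})"
proof (rule integrable_real_indicator)
  show "emeasure lborel {a<..<b} < \<infinity>"
    by (rule emeasure_bounded_finite) (auto simp: bounded_real intro!: exI[of _ "max \<bar>a\<bar> \<bar>b\<bar>"])
qed simp

lemma sq_integrable_measurable: "sq_integrable f \<Longrightarrow> f \<in> borel_measurable borel"
  by (simp add: sq_integrable_def)

lemma sq_integrable_restr_bounded: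
  assumes m: "restr d f \<in> borel_measurable borel" and "\<And>x. x \<in> {-d<..<0} \<Longrightarrow> \<bar>f x\<bar> \<le> C"
  shows "sq_integrable (restr d f)"
  unfolding sq_integrable_def
proof
  show "integrable lborel (\<lambda>x. (restr d f x)\<^sup>2)"
  proof (rule Bochner_Integration.integrable_bound)
    show "integrable lborel (\<lambda>x. indicat_real {-d<..<0} x * C\<^sup>2)"
      by (intro integrable_mult_left integrable_indicator_interval)
    show "AE x in lborel. norm ((restr d f x)\<^sup>2) \<le> norm (indicat_real {-d<..<0} x * C\<^sup>2)"
    proof (rule AE_I2)
      fix x
      show "norm ((restr d f x)\<^sup>2) \<le> norm (indicat_real {-d<..<0} x * C\<^sup>2)"
      proof (cases "x \<in> {-d<..<0}")
        case True
        then have "\<bar>f x\<bar> \<le> \<bar>C\<bar>" using assms(2)[of x] by simp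
        then show ?thesis using True
          by (simp add: restr_def abs_le_square_iff)
      qed (auto simp: restr_def)
    qed
  qed (use m in measurable)
qed (use m in simp)

lemma rep_to_L2:
  assumes "sq_integrable (restr d f)"
  shows "AE x in lborel. rep_L2fun (to_L2 d f) x = restr d f x"
  using rep_abs_L2fun(2)[OF assms] by (simp add: to_L2_eq)

lemma to_L2_in_L2:
  assumes "sq_integrable (restr d f)"
  shows "to_L2 d f \<in> L2 d"
  unfolding L2_def mem_Collect_eq
  using rep_to_L2[OF assms] by eventually_elim (auto simp: restr_def)

lemma to_L2_cong:
  assumes "\<And>x. x \<in> {-d<..<0} \<Longrightarrow> f x = g x"
  shows "to_L2 d f = to_L2 d g"
proof -
  have "restr d f = restr d g"
    using assms by (auto simp: restr_def indicator_def)
  then show ?thesis by (simp add: to_L2_eq)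
qed

text \<open>A member of \<open>L2 d\<close> vanishes almost everywhere outside the interval, so
  cutting off its representative does not change the class. Facts proved for \<open>to_L2\<close>
  thereby reach every element of \<open>L2 d\<close>.\<close>

lemma to_L2_rep:
  assumes "u \<in> L2 d"
  shows "sq_integrable (restr d (rep_L2fun u))" "to_L2 d (rep_L2fun u) = u"
proof -
  have m: "rep_L2fun u \<in> borel_measurable borel"
    using sq_integrable_rep[of u] by (rule sq_integrable_measurable)
  then have [measurable]: "restr d (rep_L2fun u) \<in> borel_measurable borel"
    unfolding restr_def[abs_def] by measurable
  have ae: "AE x in lborel. rep_L2fun u x = restr d (rep_L2fun u) x"
    using assms unfolding L2_def by (auto simp: restr_def indicator_def elim!: AE_mp)
  have "integrable lborel (\<lambda>x. (rep_L2fun u x)\<^sup>2)"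
    using sq_integrable_rep[of u] by (simp add: sq_integrable_def)
  then have "integrable lborel (\<lambda>x. (restr d (rep_L2fun u) x)\<^sup>2)"
    by (rule integrable_cong_AE_imp) (use ae in auto)
  then show s: "sq_integrable (restr d (rep_L2fun u))"
    by (simp add: sq_integrable_def)
  show "to_L2 d (rep_L2fun u) = u"
    using rep_to_L2[OF s] ae by (intro L2fun_eqI) (auto elim: AE_mp)
qed

lemma restr_lincomb: "restr d (\<lambda>s. a * f s + b * g s) = (\<lambda>s. a * restr d f s + b * restr d g s)"
  by (auto simp: restr_def algebra_simps)

lemma sq_integrable_restr_lincomb:
  assumes "sq_integrable (restr d f)" "sq_integrable (restr d g)"
  shows "sq_integrable (restr d (\<lambda>s. a * f s + b * g s))"
  unfolding restr_lincomb by (intro sq_integrable_add sq_integrable_scale assms)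

lemma to_L2_lincomb:
  assumes "sq_integrable (restr d f)" "sq_integrable (restr d g)"
  shows "to_L2 d (\<lambda>s. a * f s + b * g s) = a *\<^sub>R to_L2 d f + b *\<^sub>R to_L2 d g"
  unfolding to_L2_eq restr_lincomb
  using assms by (simp add: scaleR_L2fun.abs_eq plus_L2fun.abs_eq sq_integrable_scale)

lemma restr_scale: "restr d (\<lambda>s. c * f s) = (\<lambda>s. c * restr d f s)"
  by (auto simp: restr_def)

lemma sq_integrable_restr_scale:
  "sq_integrable (restr d f) \<Longrightarrow> sq_integrable (restr d (\<lambda>s. c * f s))"
  unfolding restr_scale by (rule sq_integrable_scale)

lemma to_L2_scale:
  "sq_integrable (restr d f) \<Longrightarrow> to_L2 d (\<lambda>s. c * f s) = c *\<^sub>R to_L2 d f"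
  unfolding to_L2_eq restr_scale by (simp add: scaleR_L2fun.abs_eq)

text \<open>The interval has finite measure, so its indicator is square integrable, and a product of
  two square-integrable functions is integrable.\<close>

lemma integrable_restr:
  assumes "sq_integrable (restr d f)"
  shows "integrable lborel (restr d f)"
proof -
  have "sq_integrable (restr d (\<lambda>_. 1))"
    by (rule sq_integrable_restr_bounded[where C=1]) (auto simp: restr_def[abs_def])
  from sq_integrable_mult[OF this assms] show ?thesis
    by (rule back_subst[of "integrable lborel"]) (auto simp: restr_def indicator_def)
qed

section \<open>Norms and bounded convergence on the delay interval\<close>

lemma norm_to_L2:
  assumes "sq_integrable (restr d f)"
  shows "norm (to_L2 d f) = sqrt (LBINT s. (restr d f s)\<^sup>2)"
  using assms unfolding norm_L2fun_def to_L2_eq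
  by (simp add: inner_L2fun.abs_eq power2_eq_square)

text \<open>On an interval of finite length, bounded pointwise convergence is enough: the squared
  norm of the difference is an integral whose integrand is dominated by \<open>(2*C)\<^sup>2\<close>
  on the interval.\<close>

lemma to_L2_tendsto:
  assumes m: "\<And>n::nat. restr d (f n) \<in> borel_measurable borel" "restr d g \<in> borel_measurable borel"
    and le: "\<And>n x. x \<in> {-d<..<0} \<Longrightarrow> \<bar>f n x\<bar> \<le> C"
    and lim: "\<And>x. x \<in> {-d<..<0} \<Longrightarrow> (\<lambda>n. f n x) \<longlonglongrightarrow> g x"
  shows "(\<lambda>n. to_L2 d (f n)) \<longlonglongrightarrow> to_L2 d g"
proof -
  have leg: "\<bar>g x\<bar> \<le> C" if "x \<in> {-d<..<0}" for x
    by (rule tendsto_upperbound[OF tendsto_rabs[OF lim[OF that]]]) (use le that in auto)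
  have sf: "sq_integrable (restr d (f n))" for n
    by (rule sq_integrable_restr_bounded[where C=C]) (use m le in auto)
  have sg: "sq_integrable (restr d g)"
    by (rule sq_integrable_restr_bounded[where C=C]) (use m leg in auto)
  have eq: "to_L2 d (f n) - to_L2 d g = to_L2 d (\<lambda>s. 1 * f n s + (-1) * g s)" for n
    by (simp only: to_L2_lincomb[OF sf sg]) simp
  have lim0: "(\<lambda>n. LBINT s. (restr d (\<lambda>s. 1 * f n s + (-1) * g s) s)\<^sup>2) \<longlonglongrightarrow> (LBINT s::real. 0)"
  proof (rule integral_dominated_convergence)
    show "integrable lborel (\<lambda>x. indicat_real {-d<..<0} x * (2*C)\<^sup>2)"
      by (intro integrable_mult_left integrable_indicator_interval)
    show "AE x in lborel. (\<lambda>n. (restr d (\<lambda>s. 1 * f n s + - 1 * g s) x)\<^sup>2) \<longlonglongrightarrow> 0"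
    proof (rule AE_I2)
      fix x
      show "(\<lambda>n. (restr d (\<lambda>s. 1 * f n s + - 1 * g s) x)\<^sup>2) \<longlonglongrightarrow> 0"
      proof (cases "x \<in> {-d<..<0}")
        case True
        have "(\<lambda>n. (f n x - g x)\<^sup>2) \<longlonglongrightarrow> (g x - g x)\<^sup>2"
          by (intro tendsto_intros lim True)
        then show ?thesis using True by (simp add: restr_def)
      qed (auto simp: restr_def)
    qed
    show "AE x in lborel. norm ((restr d (\<lambda>s. 1 * f n s + - 1 * g s) x)\<^sup>2)
        \<le> indicat_real {-d<..<0} x * (2*C)\<^sup>2" for n
    proof (rule AE_I2)
      fix x
      show "norm ((restr d (\<lambda>s. 1 * f n s + - 1 * g s) x)\<^sup>2) \<le> indicat_real {-d<..<0} x * (2*C)\<^sup>2"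
      proof (cases "x \<in> {-d<..<0}")
        case True
        have "\<bar>f n x - g x\<bar> \<le> \<bar>2 * C\<bar>" using le[OF True, of n] leg[OF True] by linarith
        then have "(f n x - g x)\<^sup>2 \<le> (2*C)\<^sup>2" by (simp only: abs_le_square_iff)
        then show ?thesis using True by (simp add: restr_def)
      qed (auto simp: restr_def)
    qed
    show "(\<lambda>s. (restr d (\<lambda>s. 1 * f n s + - 1 * g s) s)\<^sup>2) \<in> borel_measurable lborel" for n
      unfolding restr_lincomb using m by measurable
  qed simp
  have "(\<lambda>n. norm (to_L2 d (f n) - to_L2 d g)) \<longlonglongrightarrow> 0"
    unfolding eq norm_to_L2[OF sq_integrable_restr_lincomb[OF sf sg]]
    using tendsto_real_sqrt[OF lim0] by simp
  then have "(\<lambda>n. to_L2 d (f n) - to_L2 d g) \<longlonglongrightarrow> 0"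
    by (rule tendsto_norm_zero_cancel)
  then show ?thesis
    by (rule LIM_zero_cancel)
qed

text \<open>The points of disagreement in the open interval form a set that is both open and
  negligible, hence empty. Continuity carries the equality to the two endpoints.\<close>

lemma continuous_AE_eq_imp_eq:
  fixes f f' :: "real \<Rightarrow> real"
  assumes c: "continuous_on {a..b} f" "continuous_on {a..b} f'" and "a < b"
    and ae: "AE x in lborel. x \<in> {a<..<b} \<longrightarrow> f x = f' x" and s: "s \<in> {a..b}"
  shows "f s = f' s"
proof -
  have "open {x \<in> {a<..<b}. f x - f' x \<noteq> 0}"
  proof -
    have "continuous_on {a<..<b} (\<lambda>x. f x - f' x)"
      by (intro continuous_intros continuous_on_subset[OF c(1)] continuous_on_subset[OF c(2)]) auto
    then have "open ({a<..<b} \<inter> (\<lambda>x. f x - f' x) -` (- {0}))"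
      by (rule continuous_open_preimage) auto
    then show ?thesis by (rule back_subst[where P="open"]) auto
  qed
  moreover have "negligible {x \<in> {a<..<b}. f x - f' x \<noteq> 0}"
  proof -
    have "AE x in lebesgue. x \<in> {a<..<b} \<longrightarrow> f x = f' x"
      using ae by (rule AE_completion)
    then obtain N where "negligible N" "{x. \<not> (x \<in> {a<..<b} \<longrightarrow> f x = f' x)} \<subseteq> N"
      unfolding eventually_ae_filter_negligible by blast
    then show ?thesis
      by (elim negligible_subset) auto
  qed
  ultimately have "{x \<in> {a<..<b}. f x - f' x \<noteq> 0} = {}"
    using open_not_negligible by blast
  then have eq: "f x - f' x = 0" if "x \<in> {a<..<b}" for x using that by blast
  have "continuous_on (closure {a<..<b}) (\<lambda>x. f x - f' x)"
    using c \<open>a < b\<close> by (auto intro!: continuous_intros)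
  from continuous_constant_on_closure[OF this eq] s \<open>a < b\<close> show ?thesis by auto
qed

text \<open>Two continuous representatives agree everywhere on the closed interval by
  \<open>continuous_AE_eq_imp_eq\<close>, so the definite description has exactly one
  candidate.\<close>

lemma cont_value_to_L2:
  assumes "continuous_on {-d..0} f" "d > 0" "s \<in> {-d..0}" and sq: "sq_integrable (restr d f)"
  shows "cont_value d (to_L2 d f) s = f s"
  unfolding cont_value_def
proof (rule the_equality)
  have ae: "AE \<xi> in lborel. \<xi> \<in> {-d<..<0} \<longrightarrow> rep_L2fun (to_L2 d f) \<xi> = f \<xi>"
    using rep_to_L2[OF sq] by eventually_elim (auto simp: restr_def)
  then show "\<exists>f'. continuous_on {-d..0} f' \<and>
      (AE \<xi> in lborel. \<xi> \<in> {-d<..<0} \<longrightarrow> rep_L2fun (to_L2 d f) \<xi> = f' \<xi>) \<and> f' s = f s"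
    using assms by blast
  fix y
  assume "\<exists>f'. continuous_on {-d..0} f' \<and>
      (AE \<xi> in lborel. \<xi> \<in> {-d<..<0} \<longrightarrow> rep_L2fun (to_L2 d f) \<xi> = f' \<xi>) \<and> f' s = y"
  then obtain f' where f': "continuous_on {-d..0} f'" "f' s = y"
    "AE \<xi> in lborel. \<xi> \<in> {-d<..<0} \<longrightarrow> rep_L2fun (to_L2 d f) \<xi> = f' \<xi>" by blast
  from f'(3) ae have "AE \<xi> in lborel. \<xi> \<in> {-d<..<0} \<longrightarrow> f' \<xi> = f \<xi>"
    by eventually_elim auto
  from continuous_AE_eq_imp_eq[OF f'(1) assms(1) _ this assms(3)] assms(2) f'(2)
  show "y = f s" by simp
qed

section \<open>Weak derivatives\<close>

lemma set_integral_rep_to_L2: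
  assumes sq: "sq_integrable (restr d f)" and q: "q \<in> borel_measurable borel"
  shows "(LBINT s:{-d<..<0}. rep_L2fun (to_L2 d f) s * q s) = (LBINT s. restr d f s * q s)"
  unfolding set_lebesgue_integral_def
proof (rule integral_cong_AE)
  have [measurable]: "rep_L2fun (to_L2 d f) \<in> borel_measurable borel" "restr d f \<in> borel_measurable borel"
    using sq sq_integrable_rep by (auto intro: sq_integrable_measurable)
  note q[measurable]
  show "(\<lambda>x. indicat_real {- d<..<0} x *\<^sub>R (rep_L2fun (to_L2 d f) x * q x)) \<in> borel_measurable lborel"
    by measurable
  show "(\<lambda>x. restr d f x * q x) \<in> borel_measurable lborel"
    by measurable
  show "AE x in lborel. indicat_real {- d<..<0} x *\<^sub>R (rep_L2fun (to_L2 d f) x * q x) = restr d f x * q x"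
    using rep_to_L2[OF sq] by eventually_elim (auto simp: restr_def indicator_def)
qed

lemma test_functionE:
  assumes "test_function d \<psi>"
  obtains \<psi>' where "\<And>x. (\<psi> has_real_derivative \<psi>' x) (at x)" "deriv \<psi> = \<psi>'"
    "continuous_on UNIV \<psi>" "continuous_on UNIV \<psi>'"
    "\<And>x. x \<notin> {-d<..<0} \<Longrightarrow> \<psi> x = 0" "\<And>x. x \<notin> {-d<..<0} \<Longrightarrow> \<psi>' x = 0"
proof -
  from assms obtain D where D: "\<And>x. (\<psi> has_vector_derivative D x) (at x)" "continuous_on UNIV D"
    and supp: "closure {s. \<psi> s \<noteq> 0} \<subseteq> {-d<..<0}"
    by (auto simp: test_function_def C1_differentiable_on_def)
  have der: "(\<psi> has_real_derivative D x) (at x)" for x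
    using D(1)[of x] by (simp add: has_real_derivative_iff_has_vector_derivative)
  have zero: "\<psi> x = 0" if "x \<notin> {-d<..<0}" for x
    using supp closure_subset[of "{s. \<psi> s \<noteq> 0}"] that by auto
  have zero': "D x = 0" if x: "x \<notin> {-d<..<0}" for x
  proof -
    \<comment> \<open>Outside the closed support there is a whole neighbourhood on which
      \<open>\<psi>\<close> is zero, so its derivative vanishes there too.\<close>
    have "eventually (\<lambda>y. y \<in> - closure {s. \<psi> s \<noteq> 0}) (nhds x)"
      using supp x by (intro eventually_nhds_in_open) auto
    then have "eventually (\<lambda>y. \<psi> y = 0) (nhds x)"
      by eventually_elim (use closure_subset[of "{s. \<psi> s \<noteq> 0}"] in auto)
    from DERIV_cong_ev[THEN iffD1, OF refl this refl der[of x]]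
    show ?thesis using DERIV_unique[OF _ DERIV_const[of 0]] by blast
  qed
  have "continuous_on UNIV \<psi>"
    using der by (intro DERIV_continuous_on) auto
  with der D(2) zero zero' show ?thesis
    by (intro that[of D]) (auto intro!: DERIV_imp_deriv)
qed

lemma weak_deriv_to_L2:
  assumes "sq_integrable (restr d f)" "sq_integrable (restr d f')"
  shows "weak_deriv d (to_L2 d f) (to_L2 d f') \<longleftrightarrow>
    (\<forall>\<psi>. test_function d \<psi> \<longrightarrow>
      (LBINT s. restr d f s * deriv \<psi> s) = - (LBINT s. restr d f' s * \<psi> s))"
proof -
  have m: "\<psi> \<in> borel_measurable borel" "deriv \<psi> \<in> borel_measurable borel" if "test_function d \<psi>" for \<psi>
    using that by (auto elim!: test_functionE intro: borel_measurable_continuous_onI)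
  show ?thesis
    unfolding weak_deriv_def using assms
    by (auto simp: set_integral_rep_to_L2 m)
qed

section \<open>Smooth cutoffs and uniqueness of weak derivatives\<close>

lemma max_0_squared_has_derivative:
  "((\<lambda>x. (max 0 x)\<^sup>2) has_real_derivative 2 * max 0 x) (at x)"
proof (cases x "0::real" rule: linorder_cases)
  case less
  have "((\<lambda>x. 0) has_real_derivative 2 * max 0 x) (at x)"
    using less by simp
  then show ?thesis
    by (rule has_field_derivative_transform_within_open[where S="{..<0}"]) (use less in auto)
next
  case greater
  have "((\<lambda>x. x\<^sup>2) has_real_derivative 2 * max 0 x) (at x)"
    using greater by (auto intro!: derivative_eq_intros)
  then show ?thesis
    by (rule has_field_derivative_transform_within_open[where S="{0<..}"]) (use greater in auto)
next
  \<comment> \<open>At the corner of the positive part, squaring makes the difference quotient at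
    most \<open>\<bar>h\<bar>\<close>, so it tends to 0.\<close>
  case equal
  have "((\<lambda>h::real. (max 0 h)\<^sup>2 / h) \<longlongrightarrow> 0) (at 0)"
  proof (rule Lim_null_comparison)
    show "eventually (\<lambda>h::real. norm ((max 0 h)\<^sup>2 / h) \<le> \<bar>h\<bar>) (at 0)"
      by (rule always_eventually) (auto simp: max_def power2_eq_square)
    show "((\<lambda>h::real. \<bar>h\<bar>) \<longlongrightarrow> 0) (at 0)"
      by (rule tendsto_rabs_zero) (rule tendsto_ident_at)
  qed
  then show ?thesis using equal by (simp add: DERIV_def)
qed

text \<open>
  The functions \<open>q / (q + \<epsilon>)\<close>, with \<open>q\<close> a \<open>C\<^sup>1\<close> bump vanishing exactly outside \<open>(a,b)\<close>, increase
  to the indicator of \<open>(a,b)\<close> as \<open>\<epsilon>\<close> decreases to \<open>0\<close>.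
\<close>

definition bump :: "real \<Rightarrow> real \<Rightarrow> real \<Rightarrow> real" where
  "bump a b x = (max 0 (x - a))\<^sup>2 * (max 0 (b - x))\<^sup>2"

lemma bump_nonneg: "0 \<le> bump a b x"
  by (simp add: bump_def)

text \<open>The positive \<open>\<epsilon>\<close> keeps the denominator away from zero, so the
  quotient inherits the continuous derivative of the bump. Its support stays in the closed interval
  from \<open>a\<close> to \<open>b\<close>, a compact part of the open delay interval.\<close>

lemma test_function_bump:
  assumes "-d < a" "b < 0" "0 < \<epsilon>"
  shows "test_function d (\<lambda>x. bump a b x / (bump a b x + \<epsilon>))"
  unfolding test_function_def
proof
  define q' where "q' x = 2 * max 0 (x - a) * (max 0 (b - x))\<^sup>2 - (max 0 (x - a))\<^sup>2 * (2 * max 0 (b - x))" for x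
  have pos: "bump a b x + \<epsilon> \<noteq> 0" for x
    using bump_nonneg[of a b x] assms by linarith
  have q: "(bump a b has_real_derivative q' x) (at x)" for x
    unfolding bump_def[abs_def] q'_def
    by (rule derivative_eq_intros DERIV_chain2[OF max_0_squared_has_derivative] refl)+
       (simp add: algebra_simps)
  have "((\<lambda>x. bump a b x / (bump a b x + \<epsilon>)) has_real_derivative
      (q' x * \<epsilon>) / (bump a b x + \<epsilon>)\<^sup>2) (at x)" for x
    by (rule derivative_eq_intros q pos refl)+ (simp add: power2_eq_square algebra_simps)
  moreover have "continuous_on UNIV (\<lambda>x. (q' x * \<epsilon>) / (bump a b x + \<epsilon>)\<^sup>2)"
    unfolding q'_def by (intro continuous_intros) (use q pos in \<open>auto intro!: DERIV_continuous_on\<close>)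
  ultimately show "(\<lambda>x. bump a b x / (bump a b x + \<epsilon>)) C1_differentiable_on UNIV"
    unfolding C1_differentiable_on_def has_real_derivative_iff_has_vector_derivative
    by (intro exI conjI ballI)
  have "{s. bump a b s / (bump a b s + \<epsilon>) \<noteq> 0} \<subseteq> {a..b}"
    by (auto simp: bump_def max_def split: if_splits)
  then have "closure {s. bump a b s / (bump a b s + \<epsilon>) \<noteq> 0} \<subseteq> {a..b}"
    by (rule closure_minimal) simp
  then show "closure {s. bump a b s / (bump a b s + \<epsilon>) \<noteq> 0} \<subseteq> {-d<..<0}"
    using assms by auto
qed

text \<open>A Dynkin argument: open intervals form an intersection-stable generator of the Borel
  sets, and the sets over which \<open>u\<close> integrates to 0 are closed under complements (by
  the total integral) and countable disjoint unions. An integrable function with zero integral over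
  every Borel set is zero almost everywhere.\<close>

lemma zero_integral_intervals_imp_AE_zero:
  fixes u :: "real \<Rightarrow> real"
  assumes int: "integrable lborel u"
    and zero: "\<And>a b. (LBINT x. u x * indicat_real {a<..<b} x) = 0" and total: "(LBINT x. u x) = 0"
  shows "AE x in lborel. u x = 0"
proof (rule density_unique_real)
  show "integrable lborel (\<lambda>x::real. 0::real)" by simp
  fix A :: "real set"
  assume "A \<in> sets lborel"
  then have A: "A \<in> sigma_sets UNIV (range (\<lambda>(a, b). {a<..<b::real}))"
    by (simp add: borel_eq_box sets_measure_of)
  have stable: "Int_stable (range (\<lambda>(a, b). {a<..<b::real}))"
    by (force simp: Int_stable_def)
  have "range (\<lambda>(a, b). {a<..<b::real}) \<subseteq> Pow UNIV"
    by simp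
  from stable this A have "(LBINT x:A. u x) = 0 \<and> A \<in> sets borel"
  proof (induction rule: sigma_sets_induct_disjoint)
    fix A :: "real set" assume "A \<in> range (\<lambda>(a, b). {a<..<b})"
    then show "(LBINT x:A. u x) = 0 \<and> A \<in> sets borel"
      using zero by (auto simp: set_lebesgue_integral_def mult.commute)
  next
    fix A :: "real set" assume A: "(LBINT x:A. u x) = 0 \<and> A \<in> sets borel"
    have "(LBINT x:UNIV - A. u x) = (LBINT x. u x - indicat_real A x *\<^sub>R u x)"
      unfolding set_lebesgue_integral_def
      by (intro Bochner_Integration.integral_cong) (auto simp: indicator_def)
    also have "\<dots> = (LBINT x. u x) - (LBINT x:A. u x)"
      unfolding set_lebesgue_integral_def
      using A int by (intro Bochner_Integration.integral_diff integrable_mult_indicator) auto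
    finally have "(LBINT x:UNIV - A. u x) = (LBINT x. u x) - (LBINT x:A. u x)" .
    then show "(LBINT x:UNIV - A. u x) = 0 \<and> UNIV - A \<in> sets borel"
      using A total by (auto simp: set_lebesgue_integral_def)
  next
    fix A :: "nat \<Rightarrow> real set"
    assume A: "disjoint_family A" "\<And>i. (LBINT x:A i. u x) = 0 \<and> A i \<in> sets borel"
    have "set_integrable lborel (\<Union>i. A i) u"
      unfolding set_integrable_def using A int by (intro integrable_mult_indicator) auto
    then have "(LBINT x:(\<Union>i. A i). u x) = (\<Sum>i. LBINT x:A i. u x)"
      using A by (intro lebesgue_integral_countable_add) (auto simp: disjoint_family_on_def)
    with A show "(LBINT x:(\<Union>i. A i). u x) = 0 \<and> (\<Union>i. A i) \<in> sets borel"
      by auto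
  qed (auto simp: set_lebesgue_integral_def)
  then show "(LBINT x:A. u x) = (LBINT x:A. 0)" by simp
qed (rule int)

text \<open>Test functions with values between 0 and 1 converge to the indicator of an arbitrary
  interval at every point of the delay interval. Dominated convergence then shows that all interval
  integrals of \<open>restr d w\<close> vanish.\<close>

lemma fundamental_lemma_calculus_of_variations:
  assumes d: "d > 0" and sq: "sq_integrable (restr d w)"
    and zero: "\<And>\<psi>. test_function d \<psi> \<Longrightarrow> (LBINT s. restr d w s * \<psi> s) = 0"
  shows "AE s in lborel. restr d w s = 0"
proof (rule zero_integral_intervals_imp_AE_zero)
  show int: "integrable lborel (restr d w)"
    by (rule integrable_restr[OF sq])
  have [measurable]: "restr d w \<in> borel_measurable borel"
    using sq by (rule sq_integrable_measurable)
  show interval: "(LBINT x. restr d w x * indicat_real {a<..<b} x) = 0" for a b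
  proof -
    \<comment> \<open>Both endpoints are moved strictly inside the delay interval, as
      \<open>test_function_bump\<close> demands. The margin shrinks to zero, so the limits are the
      endpoints of the intersection of the two intervals.\<close>
    define a' where "a' n = max a (- d + d / (real n + 2))" for n
    define b' where "b' n = min b (- d / (real n + 2))" for n
    define \<psi> where "\<psi> n x = bump (a' n) (b' n) x / (bump (a' n) (b' n) x + 1 / (real n + 1))" for n x
    have a'_lim: "a' \<longlonglongrightarrow> max a (- d + 0)" and b'_lim: "b' \<longlonglongrightarrow> min b 0"
      unfolding a'_def b'_def by (intro tendsto_intros; real_asymp)+
    have e_lim: "(\<lambda>n. 1 / (real n + 1)) \<longlonglongrightarrow> 0"
      by real_asymp
    have test: "test_function d (\<psi> n)" for n
      unfolding \<psi>_def[abs_def] using d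
      by (intro test_function_bump) (auto simp: a'_def b'_def less_max_iff_disj min_less_iff_disj)
    have bounds: "0 \<le> \<psi> n x \<and> \<psi> n x \<le> 1" for n x
    proof -
      have "0 < 1 / (real n + 1)" by simp
      with bump_nonneg[of "a' n" "b' n" x] show ?thesis
        unfolding \<psi>_def by (intro conjI divide_nonneg_nonneg) (simp_all only: divide_le_eq_1, linarith+)
    qed
    have lim: "(\<lambda>n. restr d w x * \<psi> n x) \<longlonglongrightarrow> restr d w x * indicat_real {a<..<b} x" for x
    proof (cases "x \<in> {-d<..<0}")
      case True
      show ?thesis
      proof (cases "x \<in> {a<..<b}")
        case x: True
        have 1: "(\<lambda>n. bump (a' n) (b' n) x) \<longlonglongrightarrow> bump (max a (-d)) (min b 0) x"
          unfolding bump_def using a'_lim b'_lim by (intro tendsto_intros) auto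
        have 2: "bump (max a (-d)) (min b 0) x > 0"
          using x True by (auto simp: bump_def intro!: mult_pos_pos)
        have "(\<lambda>n. \<psi> n x) \<longlonglongrightarrow> bump (max a (-d)) (min b 0) x / (bump (max a (-d)) (min b 0) x + 0)"
          unfolding \<psi>_def using 2 by (intro tendsto_intros 1 e_lim) auto
        then have "(\<lambda>n. \<psi> n x) \<longlonglongrightarrow> 1" using 2 by simp
        from tendsto_mult_left[OF this, of "restr d w x"] x show ?thesis by simp
      next
        case x: False
        \<comment> \<open>The clipped interval lies inside the original one, so the bump is already
          zero at every point outside the latter.\<close>
        then have "\<psi> n x = 0" for n
          by (auto simp: \<psi>_def bump_def a'_def b'_def)
        with x show ?thesis by simp
      qed
    qed (simp add: restr_def)
    have "(\<lambda>n. LBINT x. restr d w x * \<psi> n x) \<longlonglongrightarrow> (LBINT x. restr d w x * indicat_real {a<..<b} x)"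
    proof (rule integral_dominated_convergence)
      show "integrable lborel (\<lambda>x. \<bar>restr d w x\<bar>)" using int by simp
      show "AE x in lborel. norm (restr d w x * \<psi> n x) \<le> \<bar>restr d w x\<bar>" for n
        using bounds[of n] by (auto simp: abs_mult intro!: mult_left_le AE_I2)
      show "(\<lambda>x. restr d w x * \<psi> n x) \<in> borel_measurable lborel" for n
        unfolding \<psi>_def bump_def by measurable
    qed (use lim in auto)
    moreover have "(LBINT x. restr d w x * \<psi> n x) = 0" for n
      by (rule zero[OF test])
    ultimately show ?thesis
      by (simp add: LIMSEQ_const_iff)
  qed
  have "(\<lambda>x. restr d w x * indicat_real {-d<..<0} x) = restr d w"
    by (auto simp: restr_def indicator_def)
  with interval[of "-d" 0] show "(LBINT x. restr d w x) = 0" by simp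
qed

text \<open>Two weak derivatives of the same class have a difference that integrates to zero against
  every test function, so the fundamental lemma identifies them and the description in
  \<open>wderiv\<close> is unique.\<close>

lemma wderiv_to_L2:
  assumes d: "d > 0" and sq: "sq_integrable (restr d f)" "sq_integrable (restr d f')"
    and wd: "weak_deriv d (to_L2 d f) (to_L2 d f')"
  shows "wderiv d (to_L2 d f) = to_L2 d f'"
  unfolding wderiv_def
proof (rule the_equality)
  show "to_L2 d f' \<in> L2 d \<and> weak_deriv d (to_L2 d f) (to_L2 d f')"
    using wd to_L2_in_L2[OF sq(2)] by simp
  fix u
  assume u: "u \<in> L2 d \<and> weak_deriv d (to_L2 d f) u"
  define q where "q = rep_L2fun u"
  have q: "sq_integrable (restr d q)" "to_L2 d q = u"
    using to_L2_rep u by (auto simp: q_def)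
  define w where "w s = 1 * q s + (-1) * f' s" for s
  have sw: "sq_integrable (restr d w)"
    unfolding w_def by (rule sq_integrable_restr_lincomb[OF q(1) sq(2)])
  have w: "restr d w s = restr d q s - restr d f' s" for s
    by (simp add: w_def restr_def right_diff_distrib)
  have "AE s in lborel. restr d w s = 0"
  proof (rule fundamental_lemma_calculus_of_variations[OF d sw])
    fix \<psi> assume t: "test_function d \<psi>"
    then obtain B where m[measurable]: "\<psi> \<in> borel_measurable borel" and B: "\<And>x. \<bar>\<psi> x\<bar> \<le> B"
    proof (rule test_functionE)
      assume c: "continuous_on UNIV \<psi>" and z: "\<And>x. x \<notin> {-d<..<0} \<Longrightarrow> \<psi> x = 0"
      have "bounded (\<psi> ` {-d..0})"
        by (intro compact_imp_bounded compact_continuous_image continuous_on_subset[OF c]) auto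
      then obtain B where B: "\<And>x. x \<in> {-d..0} \<Longrightarrow> \<bar>\<psi> x\<bar> \<le> B"
        unfolding bounded_iff by (metis image_eqI real_norm_def)
      then have "\<bar>\<psi> x\<bar> \<le> \<bar>B\<bar>" for x
        using z[of x] order_trans[OF B abs_ge_self]
        by (cases "x \<in> {-d<..<0}") auto
      then show ?thesis using c by (intro that) (auto intro: borel_measurable_continuous_onI)
    qed
    have int: "integrable lborel (\<lambda>s. restr d p s * \<psi> s)" if p: "sq_integrable (restr d p)" for p
    proof (rule Bochner_Integration.integrable_bound)
      show "integrable lborel (\<lambda>s. restr d p s * B)"
        by (intro integrable_mult_left integrable_restr p)
      show "(\<lambda>s. restr d p s * \<psi> s) \<in> borel_measurable lborel"
        using sq_integrable_measurable[OF p] by measurable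
      show "AE x in lborel. norm (restr d p x * \<psi> x) \<le> norm (restr d p x * B)"
        using B by (intro AE_I2) (auto simp: abs_mult intro!: mult_left_mono order_trans[OF B])
    qed
    have "(LBINT s. restr d q s * \<psi> s) = (LBINT s. restr d f' s * \<psi> s)"
      using u wd t unfolding q(2)[symmetric] weak_deriv_to_L2[OF sq(1) q(1)] weak_deriv_to_L2[OF sq]
      by simp
    then show "(LBINT s. restr d w s * \<psi> s) = 0"
      unfolding w left_diff_distrib using int[OF q(1)] int[OF sq(2)] by simp
  qed
  then have "AE s in lborel. restr d q s = restr d f' s"
    by eventually_elim (simp add: w)
  then show "u = to_L2 d f'"
    unfolding q(2)[symmetric] to_L2_eq by (intro abs_L2fun_eq q(1) sq(2))
qed

section \<open>Convolution with a square-integrable delay kernel\<close>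

definition conv :: "(real \<Rightarrow> real) \<Rightarrow> (real \<Rightarrow> real) \<Rightarrow> real \<Rightarrow> real" where
  "conv p k x = (LBINT y. p y * k (x - y))"

lemma conv_integrable:
  fixes p k :: "real \<Rightarrow> real"
  assumes p: "integrable lborel p" and [measurable]: "k \<in> borel_measurable borel" and le: "\<And>s. \<bar>k s\<bar> \<le> C"
  shows "integrable lborel (\<lambda>y. p y * k (x - y))"
proof (rule Bochner_Integration.integrable_bound)
  show "integrable lborel (\<lambda>y. p y * C)" using p by simp
  have [measurable]: "p \<in> borel_measurable borel" using p by simp
  show "(\<lambda>y. p y * k (x - y)) \<in> borel_measurable lborel" by measurable
  show "AE y in lborel. norm (p y * k (x - y)) \<le> norm (p y * C)"
    using le by (intro AE_I2) (auto simp: abs_mult intro!: mult_left_mono order_trans[OF le])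
qed

lemma conv_bound:
  assumes p: "integrable lborel p" and k: "k \<in> borel_measurable borel" and le: "\<And>s. \<bar>k s\<bar> \<le> C"
  shows "\<bar>conv p k x\<bar> \<le> (LBINT y. \<bar>p y\<bar>) * C"
proof -
  have "\<bar>conv p k x\<bar> \<le> (LBINT y. \<bar>p y * k (x - y)\<bar>)"
    unfolding conv_def using integral_norm_bound[of lborel "\<lambda>y. p y * k (x - y)"] by simp
  also have "\<dots> \<le> (LBINT y. \<bar>p y\<bar> * C)"
  proof (rule integral_mono)
    show "integrable lborel (\<lambda>y. \<bar>p y * k (x - y)\<bar>)" "integrable lborel (\<lambda>y. \<bar>p y\<bar> * C)"
      using p conv_integrable[OF p k le, of x] by (auto simp del: abs_mult)
    show "\<bar>p y * k (x - y)\<bar> \<le> \<bar>p y\<bar> * C" for y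
      unfolding abs_mult by (intro mult_left_mono le) simp
  qed
  finally show ?thesis by simp
qed

lemma conv_measurable [measurable]:
  assumes [measurable]: "p \<in> borel_measurable borel" "k \<in> borel_measurable borel"
  shows "conv p k \<in> borel_measurable borel"
  unfolding conv_def[abs_def] by measurable

lemma conv_lincomb:
  assumes p: "integrable lborel p"
    and k: "k \<in> borel_measurable borel" "\<And>s. \<bar>k s\<bar> \<le> C"
    and l: "l \<in> borel_measurable borel" "\<And>s. \<bar>l s\<bar> \<le> C'"
  shows "conv p (\<lambda>s. a * k s + b * l s) x = a * conv p k x + b * conv p l x"
  using conv_integrable[OF p k, of x] conv_integrable[OF p l, of x]
  by (simp add: conv_def distrib_left mult.left_commute)

text \<open>Failure of convergence at \<open>s\<^sub>0\<close> concerns the single integration point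
  \<open>x - s\<^sub>0\<close>, a null set. This leaves room for a kernel whose time derivative
  jumps.\<close>

lemma conv_tendsto:
  fixes k :: "nat \<Rightarrow> real \<Rightarrow> real"
  assumes p: "integrable lborel p"
    and [measurable]: "\<And>n. k n \<in> borel_measurable borel" "l \<in> borel_measurable borel"
    and le: "\<And>n s. \<bar>k n s\<bar> \<le> C" and lim: "\<And>s. s \<noteq> s\<^sub>0 \<Longrightarrow> (\<lambda>n. k n s) \<longlonglongrightarrow> l s"
  shows "(\<lambda>n. conv p (k n) x) \<longlonglongrightarrow> conv p l x"
  unfolding conv_def
proof (rule integral_dominated_convergence)
  show "integrable lborel (\<lambda>y. \<bar>p y\<bar> * C)" using p by simp
  have [measurable]: "p \<in> borel_measurable borel" using p by simp
  show "(\<lambda>y. p y * l (x - y)) \<in> borel_measurable lborel" by measurable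
  show "(\<lambda>y. p y * k n (x - y)) \<in> borel_measurable lborel" for n by measurable
  show "AE y in lborel. (\<lambda>n. p y * k n (x - y)) \<longlonglongrightarrow> p y * l (x - y)"
    using AE_lborel_singleton[of "x - s\<^sub>0"]
    by eventually_elim (auto intro!: tendsto_intros lim)
  show "AE y in lborel. norm (p y * k n (x - y)) \<le> \<bar>p y\<bar> * C" for n
    using le by (intro AE_I2) (auto simp: abs_mult intro!: mult_left_mono)
qed

lemma sq_integrable_conv:
  assumes p: "integrable lborel p" and k: "k \<in> borel_measurable borel" "\<And>s. \<bar>k s\<bar> \<le> C"
  shows "sq_integrable (restr d (conv p k))"
proof (rule sq_integrable_restr_bounded[OF _ conv_bound[OF p k]])
  have [measurable]: "p \<in> borel_measurable borel" using p by simp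
  note k(1)[measurable]
  show "restr d (conv p k) \<in> borel_measurable borel"
    unfolding restr_def[abs_def] by measurable
qed

lemma to_L2_conv_lincomb:
  assumes p: "integrable lborel p"
    and k: "k \<in> borel_measurable borel" "\<And>s. \<bar>k s\<bar> \<le> C"
    and l: "l \<in> borel_measurable borel" "\<And>s. \<bar>l s\<bar> \<le> C'"
  shows "to_L2 d (conv p (\<lambda>s. a * k s + b * l s)) = a *\<^sub>R to_L2 d (conv p k) + b *\<^sub>R to_L2 d (conv p l)"
  using to_L2_lincomb[OF sq_integrable_conv[OF p k] sq_integrable_conv[OF p l], of d a b]
  by (simp add: conv_lincomb[OF p k l, abs_def])

lemma to_L2_conv_tendsto:
  fixes k :: "nat \<Rightarrow> real \<Rightarrow> real"
  assumes p: "integrable lborel p"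
    and k: "\<And>n. k n \<in> borel_measurable borel" and l: "l \<in> borel_measurable borel"
    and le: "\<And>n s. \<bar>k n s\<bar> \<le> C" and lim: "\<And>s. s \<noteq> s\<^sub>0 \<Longrightarrow> (\<lambda>n. k n s) \<longlonglongrightarrow> l s"
  shows "(\<lambda>n. to_L2 d (conv p (k n))) \<longlonglongrightarrow> to_L2 d (conv p l)"
proof (rule to_L2_tendsto)
  have [measurable]: "p \<in> borel_measurable borel" using p by simp
  note k[measurable] l[measurable]
  show "restr d (conv p (k n)) \<in> borel_measurable borel" for n
    unfolding restr_def[abs_def] by measurable
  show "restr d (conv p l) \<in> borel_measurable borel"
    unfolding restr_def[abs_def] by measurable
  show "\<bar>conv p (k n) x\<bar> \<le> (LBINT y. \<bar>p y\<bar>) * C" for n x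
    by (rule conv_bound[OF p k le])
  show "(\<lambda>n. conv p (k n) x) \<longlonglongrightarrow> conv p l x" for x
    by (rule conv_tendsto[OF p k l le lim])
qed

text \<open>The product integrand is dominated by a constant multiple of \<open>p y * q x\<close>,
  so Fubini applies. Afterwards the test function meets only the kernel \<open>k\<close>, while
  \<open>p\<close> is left undifferentiated.\<close>

lemma integral_conv_mult:
  assumes p: "integrable lborel p" and q: "integrable lborel q"
    and k [measurable]: "k \<in> borel_measurable borel" and le: "\<And>s. \<bar>k s\<bar> \<le> C"
  shows "(LBINT x. conv p k x * q x) = (LBINT y. p y * (LBINT x. k (x - y) * q x))"
    and "integrable lborel (\<lambda>y. p y * (LBINT x. k (x - y) * q x))"
proof -
  have [measurable]: "p \<in> borel_measurable borel" "q \<in> borel_measurable borel" using p q by simp_all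
  have "integrable (lborel \<Otimes>\<^sub>M lborel) (\<lambda>(y, x). p y * q x)"
    by (rule lborel_pair.Fubini_integrable) (use p q in \<open>auto simp: abs_mult\<close>)
  then have "integrable (lborel \<Otimes>\<^sub>M lborel) (\<lambda>z. (case z of (y, x) \<Rightarrow> p y * q x) * C)"
    by simp
  then have int: "integrable (lborel \<Otimes>\<^sub>M lborel) (\<lambda>(y, x). p y * k (x - y) * q x)"
  proof (rule Bochner_Integration.integrable_bound)
    show "AE z in lborel \<Otimes>\<^sub>M lborel. norm (case z of (y, x) \<Rightarrow> p y * k (x - y) * q x)
        \<le> norm ((case z of (y, x) \<Rightarrow> p y * q x) * C)"
    proof (rule AE_I2, clarify)
      fix y x :: real
      have "\<bar>p y * q x\<bar> * \<bar>k (x - y)\<bar> \<le> \<bar>p y * q x\<bar> * \<bar>C\<bar>"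
        by (intro mult_left_mono order_trans[OF le]) auto
      then show "norm (p y * k (x - y) * q x) \<le> norm (p y * q x * C)"
        by (simp add: abs_mult ac_simps)
    qed
  qed measurable
  have "(LBINT x. conv p k x * q x) = (LBINT x. LBINT y. p y * k (x - y) * q x)"
    by (simp add: conv_def)
  also have "\<dots> = (LBINT y. LBINT x. p y * k (x - y) * q x)"
    by (rule lborel_pair.Fubini_integral) (rule int)
  finally show "(LBINT x. conv p k x * q x) = (LBINT y. p y * (LBINT x. k (x - y) * q x))"
    by (simp add: mult.assoc)
  show "integrable lborel (\<lambda>y. p y * (LBINT x. k (x - y) * q x))"
    using lborel_pair.integrable_fst[OF int] by (simp add: mult.assoc)
qed

section \<open>Weak differentiation of a convolution\<close>

lemma integrable_test_function:
  fixes q :: "real \<Rightarrow> real"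
  assumes "continuous_on UNIV q" and "\<And>x. x \<notin> {-d<..<0} \<Longrightarrow> q x = 0"
  shows "integrable lborel q"
proof -
  have "integrable lborel (\<lambda>x. indicat_real {-d..0} x *\<^sub>R q x)"
    by (intro borel_integrable_compact continuous_on_subset[OF assms(1)]) auto
  moreover have "(\<lambda>x. indicat_real {-d..0} x *\<^sub>R q x) = q"
  proof
    show "indicat_real {-d..0} x *\<^sub>R q x = q x" for x
      using assms(2)[of x] by (cases "x \<in> {-d<..<0}") (auto simp: indicator_def)
  qed
  ultimately show ?thesis by simp
qed

lemma indicator_Icc_measurable_bounded:
  fixes \<kappa> :: "real \<Rightarrow> real"
  assumes "continuous_on {a..b} \<kappa>"
  shows "(\<lambda>s. indicat_real {a..b} s * \<kappa> s) \<in> borel_measurable borel"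
    and "\<exists>C. \<forall>s. \<bar>indicat_real {a..b} s * \<kappa> s\<bar> \<le> C"
proof -
  show "(\<lambda>s. indicat_real {a..b} s * \<kappa> s) \<in> borel_measurable borel"
    using borel_measurable_continuous_on_indicator[OF _ assms] by simp
  have "bounded (\<kappa> ` {a..b})"
    by (intro compact_imp_bounded compact_continuous_image assms) auto
  then obtain C where "\<forall>s\<in>{a..b}. \<bar>\<kappa> s\<bar> \<le> C"
    unfolding bounded_iff by (metis image_eqI real_norm_def)
  then have "\<bar>indicat_real {a..b} s * \<kappa> s\<bar> \<le> \<bar>C\<bar>" for s
    by (cases "s \<in> {a..b}") (auto intro: order_trans[OF _ abs_ge_self])
  then show "\<exists>C. \<forall>s. \<bar>indicat_real {a..b} s * \<kappa> s\<bar> \<le> C" by blast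
qed

text \<open>
  As \<open>\<kappa> T = 0\<close>, the kernel jumps only at \<open>0\<close>; this jump is the source of the term \<open>\<kappa> 0 * p\<close>.
\<close>

lemma weak_deriv_conv:
  assumes p: "sq_integrable (restr d p)" and T: "0 \<le> T"
    and der: "\<And>s. s \<in> {0..T} \<Longrightarrow> (\<kappa> has_real_derivative \<kappa>' s) (at s within {0..T})"
    and cont': "continuous_on {0..T} \<kappa>'" and end0: "\<kappa> T = 0"
  defines "k \<equiv> \<lambda>s. indicat_real {0..T} s * \<kappa> s" and "k' \<equiv> \<lambda>s. indicat_real {0..T} s * \<kappa>' s"
  shows "weak_deriv d (to_L2 d (conv (restr d p) k)) (\<kappa> 0 *\<^sub>R to_L2 d p + to_L2 d (conv (restr d p) k'))"
proof -
  have cont: "continuous_on {0..T} \<kappa>"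
    using der by (intro DERIV_continuous_on)
  note intp = integrable_restr[OF p]
  obtain C where mk: "k \<in> borel_measurable borel" and C: "\<And>s. \<bar>k s\<bar> \<le> C"
    using indicator_Icc_measurable_bounded[OF cont] unfolding k_def by blast
  obtain C' where mk': "k' \<in> borel_measurable borel" and C': "\<And>s. \<bar>k' s\<bar> \<le> C'"
    using indicator_Icc_measurable_bounded[OF cont'] unfolding k'_def by blast
  define w where "w x = \<kappa> 0 * p x + 1 * conv (restr d p) k' x" for x
  have w: "to_L2 d w = \<kappa> 0 *\<^sub>R to_L2 d p + to_L2 d (conv (restr d p) k')"
    unfolding w_def by (subst to_L2_lincomb[OF p sq_integrable_conv[OF intp mk' C']]) simp
  have sw: "sq_integrable (restr d w)"
    unfolding w_def by (intro sq_integrable_restr_lincomb p sq_integrable_conv[OF intp mk' C'])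
  have "(LBINT s. restr d (conv (restr d p) k) s * deriv \<psi> s) = - (LBINT s. restr d w s * \<psi> s)"
    if "test_function d \<psi>" for \<psi>
    using that
  proof (rule test_functionE)
    fix \<psi>'
    assume d: "\<And>x. (\<psi> has_real_derivative \<psi>' x) (at x)" "deriv \<psi> = \<psi>'"
      and c: "continuous_on UNIV \<psi>" "continuous_on UNIV \<psi>'"
      and z: "\<And>x. x \<notin> {-d<..<0} \<Longrightarrow> \<psi> x = 0" "\<And>x. x \<notin> {-d<..<0} \<Longrightarrow> \<psi>' x = 0"
    have int\<psi>: "integrable lborel \<psi>" "integrable lborel \<psi>'"
      by (rule integrable_test_function[where d=d], rule c, rule z, assumption)+
    \<comment> \<open>After the translation \<open>x = y + s\<close> this is integration by parts on
      the support of the kernel. The boundary term at \<open>T\<close> drops out by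
      \<open>end0\<close>, and the one at 0 gives \<open>- \<kappa> 0 * \<psi> y\<close>.\<close>
    have parts: "(LBINT x. k (x - y) * \<psi>' x) = - \<kappa> 0 * \<psi> y - (LBINT x. k' (x - y) * \<psi> x)" for y
    proof -
      have c\<psi>: "continuous_on {0..T} (\<lambda>s. \<psi> (y + s))" "continuous_on {0..T} (\<lambda>s. \<psi>' (y + s))"
        by (intro continuous_on_compose2[OF c(1)] continuous_on_compose2[OF c(2)] continuous_intros; simp)+
      have i: "integrable lborel (\<lambda>s. indicat_real {0..T} s *\<^sub>R (\<kappa>' s * \<psi> (y + s)))"
        "integrable lborel (\<lambda>s. indicat_real {0..T} s *\<^sub>R (\<kappa> s * \<psi>' (y + s)))"
        by (intro borel_integrable_compact continuous_intros cont cont' c\<psi>; simp)+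
      have "(LBINT s. indicat_real {0..T} s *\<^sub>R (\<kappa>' s * \<psi> (y + s) + \<kappa> s * \<psi>' (y + s)))
          = \<kappa> T * \<psi> (y + T) - \<kappa> 0 * \<psi> (y + 0)"
      proof (rule integral_FTC_atLeastAtMost[OF T])
        fix s assume s: "0 \<le> s" "s \<le> T"
        have 1: "((\<lambda>s. \<psi> (y + s)) has_real_derivative \<psi>' (y + s)) (at s within {0..T})"
          by (rule DERIV_cong[OF DERIV_chain2[OF d(1)]]) (rule derivative_eq_intros refl | simp)+
        have 2: "(\<kappa> has_real_derivative \<kappa>' s) (at s within {0..T})"
          using der s by auto
        from DERIV_mult[OF 2 1]
        show "((\<lambda>s. \<kappa> s * \<psi> (y + s)) has_vector_derivative \<kappa>' s * \<psi> (y + s) + \<kappa> s * \<psi>' (y + s))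
            (at s within {0..T})"
          unfolding has_real_derivative_iff_has_vector_derivative[symmetric]
          by (rule DERIV_cong) simp
      qed (intro continuous_intros cont cont' c\<psi>)
      also have "(LBINT s. indicat_real {0..T} s *\<^sub>R (\<kappa>' s * \<psi> (y + s) + \<kappa> s * \<psi>' (y + s)))
          = (LBINT s. k' s * \<psi> (y + s)) + (LBINT s. k s * \<psi>' (y + s))"
        unfolding scaleR_add_right k_def k'_def using i by (simp add: mult.assoc)
      also have "(LBINT s. k' s * \<psi> (y + s)) = (LBINT x. k' (x - y) * \<psi> x)"
        by (subst (2) lborel_integral_real_affine[where c=1 and t=y]) simp_all
      also have "(LBINT s. k s * \<psi>' (y + s)) = (LBINT x. k (x - y) * \<psi>' x)"
        by (subst (2) lborel_integral_real_affine[where c=1 and t=y]) simp_all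
      finally show ?thesis by (simp add: end0)
    qed
    have "bounded (\<psi> ` {-d..0})"
      by (intro compact_imp_bounded compact_continuous_image continuous_on_subset[OF c(1)]) auto
    then obtain B where B: "\<And>x. x \<in> {-d..0} \<Longrightarrow> \<bar>\<psi> x\<bar> \<le> B"
      unfolding bounded_iff by (metis image_eqI real_norm_def)
    have i1: "integrable lborel (\<lambda>y. restr d p y * \<psi> y)"
    proof (rule Bochner_Integration.integrable_bound)
      show "integrable lborel (\<lambda>y. restr d p y * B)" using intp by simp
      show "(\<lambda>y. restr d p y * \<psi> y) \<in> borel_measurable lborel"
        using sq_integrable_measurable[OF p] borel_measurable_continuous_onI[OF c(1)] by measurable
      show "AE y in lborel. norm (restr d p y * \<psi> y) \<le> norm (restr d p y * B)"
      proof (rule AE_I2)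
        fix y show "norm (restr d p y * \<psi> y) \<le> norm (restr d p y * B)"
          using B[of y] by (cases "y \<in> {-d<..<0}") (auto simp: restr_def abs_mult intro!: mult_left_mono)
      qed
    qed
    note conv\<psi> = integral_conv_mult[OF intp int\<psi>(1) mk' C']
    have "(LBINT s. restr d (conv (restr d p) k) s * deriv \<psi> s) = (LBINT s. conv (restr d p) k s * \<psi>' s)"
      using z(2) unfolding d(2)
      by (intro Bochner_Integration.integral_cong) (auto simp: restr_def indicator_def)
    also have "\<dots> = (LBINT y. restr d p y * (- \<kappa> 0 * \<psi> y - (LBINT x. k' (x - y) * \<psi> x)))"
      using integral_conv_mult(1)[OF intp int\<psi>(2) mk C] by (simp only: parts)
    also have "\<dots> = (LBINT y. - \<kappa> 0 * (restr d p y * \<psi> y) - restr d p y * (LBINT x. k' (x - y) * \<psi> x))"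
      by (simp add: algebra_simps)
    also have "\<dots> = - \<kappa> 0 * (LBINT y. restr d p y * \<psi> y) - (LBINT x. conv (restr d p) k' x * \<psi> x)"
      unfolding conv\<psi>(1) using i1 conv\<psi>(2) by simp
    also have "\<dots> = - (LBINT s. restr d w s * \<psi> s)"
    proof -
      have "restr d w x * \<psi> x = \<kappa> 0 * (restr d p x * \<psi> x) + conv (restr d p) k' x * \<psi> x" for x
        using z(1)[of x] by (auto simp: restr_def indicator_def w_def algebra_simps)
      moreover have "integrable lborel (\<lambda>x. conv (restr d p) k' x * \<psi> x)"
      proof (rule Bochner_Integration.integrable_bound)
        have [measurable]: "restr d p \<in> borel_measurable borel" "k' \<in> borel_measurable borel" "\<psi> \<in> borel_measurable borel"
          using sq_integrable_measurable[OF p] mk' borel_measurable_continuous_onI[OF c(1)] by auto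
        show "integrable lborel (\<lambda>x. (LBINT y. \<bar>restr d p y\<bar>) * C' * \<psi> x)"
          using int\<psi>(1) by simp
        show "(\<lambda>x. conv (restr d p) k' x * \<psi> x) \<in> borel_measurable lborel" by measurable
        show "AE x in lborel. norm (conv (restr d p) k' x * \<psi> x) \<le> norm ((LBINT y. \<bar>restr d p y\<bar>) * C' * \<psi> x)"
        proof (rule AE_I2)
          fix x
          have "\<bar>conv (restr d p) k' x\<bar> * \<bar>\<psi> x\<bar> \<le> \<bar>(LBINT y. \<bar>restr d p y\<bar>) * C'\<bar> * \<bar>\<psi> x\<bar>"
            by (intro mult_right_mono order_trans[OF conv_bound[OF intp mk' C'] abs_ge_self]) simp
          then show "norm (conv (restr d p) k' x * \<psi> x) \<le> norm ((LBINT y. \<bar>restr d p y\<bar>) * C' * \<psi> x)"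
            by (simp only: real_norm_def abs_mult)
        qed
      qed
      ultimately show ?thesis using i1 by simp
    qed
    finally show ?thesis .
  qed
  then have "weak_deriv d (to_L2 d (conv (restr d p) k)) (to_L2 d w)"
    by (simp add: weak_deriv_to_L2[OF sq_integrable_conv[OF intp mk C] sw])
  then show ?thesis by (simp add: w)
qed

lemma weak_deriv_scaleR:
  assumes u: "u \<in> L2 d" and v: "v \<in> L2 d" and wd: "weak_deriv d u v"
  shows "weak_deriv d (c *\<^sub>R u) (c *\<^sub>R v)"
proof -
  note rep = to_L2_rep(1)[OF u] to_L2_rep(1)[OF v]
  have "weak_deriv d (to_L2 d (rep_L2fun u)) (to_L2 d (rep_L2fun v))"
    using wd by (simp add: to_L2_rep u v)
  then have "weak_deriv d (to_L2 d (\<lambda>s. c * rep_L2fun u s)) (to_L2 d (\<lambda>s. c * rep_L2fun v s))"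
    unfolding weak_deriv_to_L2[OF rep] weak_deriv_to_L2[OF rep[THEN sq_integrable_restr_scale]]
    by (simp add: restr_scale mult.assoc)
  then show ?thesis
    by (simp add: to_L2_scale rep to_L2_rep u v)
qed

lemma wderiv_eqI:
  assumes "d > 0" "u \<in> L2 d" "v \<in> L2 d" "weak_deriv d u v"
  shows "wderiv d u = v"
  using wderiv_to_L2[OF assms(1) to_L2_rep(1)[OF assms(2)] to_L2_rep(1)[OF assms(3)]] assms(4)
  by (simp add: to_L2_rep(2)[OF assms(2)] to_L2_rep(2)[OF assms(3)])

lemma L2_subspace: "subspace (L2 d)"
proof (rule subspaceI)
  have lin: "a *\<^sub>R u + b *\<^sub>R v \<in> L2 d" if "u \<in> L2 d" "v \<in> L2 d" for a b u v
    using to_L2_lincomb[OF to_L2_rep(1)[OF that(1)] to_L2_rep(1)[OF that(2)], of a b]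
      to_L2_in_L2[OF sq_integrable_restr_lincomb[OF to_L2_rep(1)[OF that(1)] to_L2_rep(1)[OF that(2)], of a b]]
    by (simp add: to_L2_rep that)
  have z: "to_L2 d (\<lambda>_. 0) \<in> L2 d"
    by (rule to_L2_in_L2, rule sq_integrable_restr_bounded[where C=0]) (auto simp: restr_def[abs_def])
  show "0 \<in> L2 d" using lin[OF z z, of 0 0] by simp
  show "u + v \<in> L2 d" if "u \<in> L2 d" "v \<in> L2 d" for u v using lin[OF that, of 1 1] by simp
  show "c *\<^sub>R u \<in> L2 d" if "u \<in> L2 d" for c u using lin[OF that that, of c 0] by simp
qed

section \<open>The annuity functions \<open>g\<close> and \<open>h\<close>\<close>

text \<open>Used where a range of integration collapses to one point: in the equation for
  \<open>g\<close> at \<open>\<tau>R\<close> and in the one for \<open>h\<close> at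
  \<open>\<zeta> = -d\<close>.\<close>

lemma set_integral_singleton: "(LBINT x:{a}. f x) = (0 :: real)" for a :: real
proof -
  have "(\<lambda>x. indicat_real {a} x *\<^sub>R f x) = (\<lambda>x. indicat_real {a} x * f a)"
    by (auto simp: indicator_def)
  then show ?thesis by (simp add: set_lebesgue_integral_def)
qed

text \<open>Only the data entering the integral equations are fixed here; \<open>\<mu>y\<close>,
  \<open>\<sigma>y\<close> and \<open>\<kappa>\<close> act on \<open>g\<close> and \<open>h\<close>
  through \<open>\<beta>\<close> alone, which therefore stays abstract until the final
  verification.\<close>

locale annuity =
  fixes r \<delta> \<beta> d :: real and \<phi> :: L2fun and \<tau>R :: real
    and g :: "real \<Rightarrow> real" and h :: "real \<Rightarrow> real \<Rightarrow> real"
  assumes d_pos: "d > 0" and \<tau>R_pos: "\<tau>R > 0" and \<phi>_L2: "\<phi> \<in> L2 d"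
    and gh: "gh_solution r \<delta> \<beta> d \<phi> \<tau>R g h"
begin

section \<open>Boundary values and time regularity of \<open>g\<close>\<close>

lemma g_continuous: "continuous_on {0..} g"
  using gh by (simp add: gh_solution_def)

lemma h_continuous: "continuous_on ({0..} \<times> {-d..0}) (\<lambda>(t, \<zeta>). h t \<zeta>)"
  using gh by (simp add: gh_solution_def)

lemma h_continuous_fst: "\<zeta> \<in> {-d..0} \<Longrightarrow> continuous_on {0..} (\<lambda>t. h t \<zeta>)"
  by (rule continuous_on_compose2[OF h_continuous, of _ "\<lambda>t. (t, \<zeta>)", simplified])
     (auto intro!: continuous_intros)

lemma h_continuous_snd: "0 \<le> t \<Longrightarrow> continuous_on {-d..0} (h t)"
  by (rule continuous_on_compose2[OF h_continuous, of _ "\<lambda>\<zeta>. (t, \<zeta>)", simplified])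
     (auto intro!: continuous_intros)

lemma g_after: "\<tau>R \<le> t \<Longrightarrow> g t = 0"
  using gh \<tau>R_pos by (auto simp: gh_solution_def)

lemma h_after: "\<tau>R \<le> t \<Longrightarrow> \<zeta> \<in> {-d..0} \<Longrightarrow> h t \<zeta> = 0"
  using gh \<tau>R_pos by (auto simp: gh_solution_def)

text \<open>For \<open>t < \<tau>R\<close> the lower limit of the integral is the maximum of
  \<open>-d + t - \<tau>R\<close> and \<open>-d\<close>, that is \<open>-d\<close>, so the range is
  one point. This is the boundary condition required by \<open>dom_Astar\<close>.\<close>

lemma h_left_end: "0 \<le> t \<Longrightarrow> h t (-d) = 0"
proof -
  assume t: "0 \<le> t"
  have "h t (-d) = (if t < \<tau>R then LBINT \<tau>:{max (-d + t - \<tau>R) (-d)..-d}.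
      exp (- (r + \<delta>) * (-d - \<tau>)) * g (t + -d - \<tau>) * rep_L2fun \<phi> \<tau> else 0)"
    using gh t d_pos unfolding gh_solution_def by simp
  then show ?thesis by (simp add: max_def set_integral_singleton)
qed

text \<open>The right-hand side of the differential equation for \<open>g\<close>. The formula is
  continuous on the whole half-line, but it represents the derivative only up to
  \<open>\<tau>R\<close>: afterwards \<open>g\<close> and \<open>h\<close> vanish and it equals
  -1.\<close>

definition dg :: "real \<Rightarrow> real" where
  "dg t = \<beta> * g t - h t 0 - 1"

lemma dg_continuous: "continuous_on {0..} dg"
  unfolding dg_def[abs_def] using d_pos
  by (intro continuous_intros g_continuous h_continuous_fst) auto

lemma g_has_derivative:
  assumes t: "t \<in> {0..\<tau>R}"
  shows "(g has_real_derivative dg t) (at t within {0..\<tau>R})"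
proof -
  \<comment> \<open>Splitting the discount factor as \<open>exp (\<beta> * t)\<close> times
    \<open>exp (- \<beta> * \<tau>)\<close> leaves an integrand free of \<open>t\<close>, so the
    fundamental theorem of calculus and the product rule suffice.\<close>
  define m where "m \<tau> = exp (- \<beta> * \<tau>) * (h \<tau> 0 + 1)" for \<tau>
  have m: "continuous_on {0..\<tau>R} m"
    unfolding m_def[abs_def] using d_pos
    by (intro continuous_intros continuous_on_subset[OF h_continuous_fst]) auto
  have eq: "g s = exp (\<beta> * s) * (integral {0..\<tau>R} m - integral {0..s} m)" if s: "s \<in> {0..\<tau>R}" for s
  proof -
    have int: "integral {0..s} m + integral {s..\<tau>R} m = integral {0..\<tau>R} m"
      using s by (intro Henstock_Kurzweil_Integration.integral_combine integrable_continuous_real m) auto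
    have "integral {s..\<tau>R} m = (LBINT \<tau>:{s..\<tau>R}. m \<tau>)"
      using s by (intro set_borel_integral_eq_integral(2)[symmetric] borel_integrable_atLeastAtMost'
          continuous_on_subset[OF m]) auto
    also have "exp (\<beta> * s) * \<dots> = (LBINT \<tau>:{s..\<tau>R}. exp (- \<beta> * (\<tau> - s)) * (h \<tau> 0 + 1))"
      unfolding set_integral_mult_right[symmetric]
      by (intro set_lebesgue_integral_cong) (auto simp: m_def algebra_simps simp flip: exp_add)
    also have "\<dots> = g s"
    proof (cases "s < \<tau>R")
      case True
      then show ?thesis using gh s unfolding gh_solution_def by simp
    next
      case False
      then have s: "s = \<tau>R" using s by simp
      have "(LBINT \<tau>:{s..\<tau>R}. f \<tau>) = 0" for f :: "real \<Rightarrow> real"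
        unfolding s atLeastAtMost_singleton by (rule set_integral_singleton)
      then show ?thesis using s g_after[of \<tau>R] by simp
    qed
    finally show ?thesis unfolding int[symmetric] by simp
  qed
  have "((\<lambda>s. exp (\<beta> * s) * (integral {0..\<tau>R} m - integral {0..s} m)) has_real_derivative
      (exp (\<beta> * t) * \<beta>) * (integral {0..\<tau>R} m - integral {0..t} m) + (0 - m t) * exp (\<beta> * t))
      (at t within {0..\<tau>R})"
    by (rule DERIV_mult DERIV_diff DERIV_const integral_has_real_derivative[OF m t]
        | (rule derivative_eq_intros refl | simp)+)+
  also have "(exp (\<beta> * t) * \<beta>) * (integral {0..\<tau>R} m - integral {0..t} m) + (0 - m t) * exp (\<beta> * t)
      = dg t"
    unfolding dg_def eq[OF t] m_def by (simp add: algebra_simps exp_minus)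
  finally show ?thesis
    by (rule has_field_derivative_transform_within[where d=1]) (use t eq in auto)
qed

lemma dg_bounded: obtains L where "L \<ge> 0" "\<And>t. t \<in> {0..\<tau>R} \<Longrightarrow> \<bar>dg t\<bar> \<le> L"
proof -
  have "bounded (dg ` {0..\<tau>R})"
    by (intro compact_imp_bounded compact_continuous_image continuous_on_subset[OF dg_continuous]) auto
  then obtain L where "\<And>t. t \<in> {0..\<tau>R} \<Longrightarrow> \<bar>dg t\<bar> \<le> L"
    unfolding bounded_iff by (metis image_eqI real_norm_def)
  then show ?thesis
    using order_trans[OF _ abs_ge_self] by (intro that[of "\<bar>L\<bar>"]) auto
qed

text \<open>Capping the time at \<open>\<tau>R\<close> changes neither the value of \<open>g\<close>
  nor increases distances, so the derivative bound up to \<open>\<tau>R\<close> extends across the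
  kink. It later dominates the difference quotients of the kernel.\<close>

lemma g_lipschitz: obtains L where "\<And>s t. 0 \<le> s \<Longrightarrow> 0 \<le> t \<Longrightarrow> \<bar>g s - g t\<bar> \<le> L * \<bar>s - t\<bar>"
proof -
  obtain L where L: "L \<ge> 0" "\<And>t. t \<in> {0..\<tau>R} \<Longrightarrow> \<bar>dg t\<bar> \<le> L"
    by (rule dg_bounded) blast
  have le: "\<bar>g s - g t\<bar> \<le> L * \<bar>s - t\<bar>" if "s \<in> {0..\<tau>R}" "t \<in> {0..\<tau>R}" for s t
    using field_differentiable_bound[of "{0..\<tau>R}" g dg L s t] g_has_derivative L(2) that by auto
  show ?thesis
  proof (rule that[of L])
    fix s t :: real assume "0 \<le> s" "0 \<le> t"
    have "g x = g (min x \<tau>R)" for x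
      using g_after by (auto simp: min_def)
    then have "\<bar>g s - g t\<bar> = \<bar>g (min s \<tau>R) - g (min t \<tau>R)\<bar>" by metis
    also have "\<dots> \<le> L * \<bar>min s \<tau>R - min t \<tau>R\<bar>"
      using \<open>0 \<le> s\<close> \<open>0 \<le> t\<close> \<tau>R_pos by (intro le) auto
    also have "\<dots> \<le> L * \<bar>s - t\<bar>"
      using L(1) by (intro mult_left_mono) auto
    finally show "\<bar>g s - g t\<bar> \<le> L * \<bar>s - t\<bar>" .
  qed
qed

text \<open>The derivative of \<open>g\<close> on the half-line away from \<open>\<tau>R\<close>. At
  \<open>\<tau>R\<close> itself the left-hand value is taken, which makes \<open>dker_alt\<close>
  exact at the end of the support.\<close>

definition dg' :: "real \<Rightarrow> real" where
  "dg' t = (if t \<le> \<tau>R then dg t else 0)"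

lemma g_has_derivative':
  assumes "0 \<le> t" "t \<noteq> \<tau>R"
  shows "(g has_real_derivative dg' t) (at t within {0..})"
proof (cases "t < \<tau>R")
  case True
  have "(g has_real_derivative dg t) (at t within {0..\<tau>R})"
    using True assms by (intro g_has_derivative) auto
  moreover have "at t within {0..\<tau>R} = at t within {0..}"
    by (rule at_within_nhd[of _ "{..<\<tau>R}"]) (use True in auto)
  ultimately show ?thesis using True by (simp add: dg'_def)
next
  case False
  have "((\<lambda>_. 0) has_real_derivative dg' t) (at t)"
    using False assms by (simp add: dg'_def)
  then have "(g has_real_derivative dg' t) (at t)"
    by (rule has_field_derivative_transform_within_open[where S="{\<tau>R<..}"])
       (use False assms g_after in auto)
  then show ?thesis by (rule has_field_derivative_at_within)
qed

lemma dg'_continuous: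
  assumes "0 \<le> t" "t \<noteq> \<tau>R"
  shows "continuous (at t within {0..}) dg'"
proof (cases "t < \<tau>R")
  case True
  have "continuous (at t within {0..}) dg"
    using dg_continuous assms by (simp add: continuous_on_eq_continuous_within)
  moreover have "eventually (\<lambda>s. dg s = dg' s) (at t within {0..})"
    using eventually_at_filter eventually_nhds_in_open[of "{..<\<tau>R}" t] True
    by (auto simp: eventually_at_filter dg'_def elim!: eventually_mono)
  ultimately show ?thesis
    unfolding continuous_within using True by (auto simp: dg'_def elim: Lim_transform_eventually)
next
  case False
  have "eventually (\<lambda>s. 0 = dg' s) (at t within {0..})"
    using eventually_nhds_in_open[of "{\<tau>R<..}" t] False assms
    by (auto simp: eventually_at_filter dg'_def elim!: eventually_mono)
  then show ?thesis
    unfolding continuous_within using False assms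
    by (auto simp: dg'_def intro: Lim_transform_eventually[OF tendsto_const])
qed

section \<open>The delay kernel and the convolution form of \<open>h\<close>\<close>

definition ker :: "real \<Rightarrow> real \<Rightarrow> real" where
  "ker t s = indicat_real {0..\<tau>R - t} s * (exp (- (r + \<delta>) * s) * g (t + s))"

definition dker :: "real \<Rightarrow> real \<Rightarrow> real" where
  "dker t s = indicat_real {0..\<tau>R - t} s * (exp (- (r + \<delta>) * s) * dg (t + s))"

abbreviation \<phi>' :: "real \<Rightarrow> real" where "\<phi>' \<equiv> restr d (rep_L2fun \<phi>)"

lemma \<phi>'_integrable: "integrable lborel \<phi>'"
  by (intro integrable_restr to_L2_rep \<phi>_L2)

text \<open>As \<open>g\<close> vanishes after \<open>\<tau>R\<close>, the moving cutoff can be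
  replaced by a fixed one. Time then enters through \<open>g\<close> alone, which suits limits and
  difference quotients in \<open>t\<close>.\<close>

lemma ker_alt: "0 \<le> t \<Longrightarrow> ker t s = indicat_real {0..\<tau>R} s * (exp (- (r + \<delta>) * s) * g (t + s))"
  using g_after[of "t + s"] by (auto simp: ker_def indicator_def)

lemma dker_alt: "0 \<le> t \<Longrightarrow> dker t s = indicat_real {0..\<tau>R} s * (exp (- (r + \<delta>) * s) * dg' (t + s))"
  by (auto simp: dker_def dg'_def indicator_def)

lemma exp_bound: "s \<in> {0..\<tau>R} \<Longrightarrow> exp (- (r + \<delta>) * s) \<le> exp (\<bar>r + \<delta>\<bar> * \<tau>R)"
proof -
  assume s: "s \<in> {0..\<tau>R}"
  have "- (r + \<delta>) * s \<le> \<bar>r + \<delta>\<bar> * s" using s by (intro mult_right_mono) auto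
  also have "\<dots> \<le> \<bar>r + \<delta>\<bar> * \<tau>R" using s by (intro mult_left_mono) auto
  finally show ?thesis by simp
qed

lemma ker_measurable: "0 \<le> t \<Longrightarrow> ker t \<in> borel_measurable borel"
  unfolding ker_def[abs_def]
  by (intro indicator_Icc_measurable_bounded continuous_intros continuous_on_compose2[OF g_continuous]) auto

lemma dker_measurable: "0 \<le> t \<Longrightarrow> dker t \<in> borel_measurable borel"
  unfolding dker_def[abs_def]
  by (intro indicator_Icc_measurable_bounded continuous_intros continuous_on_compose2[OF dg_continuous]) auto

lemma ker_bounded: "0 \<le> t \<Longrightarrow> \<exists>C. \<forall>s. \<bar>ker t s\<bar> \<le> C"
  unfolding ker_def
  by (intro indicator_Icc_measurable_bounded continuous_intros continuous_on_compose2[OF g_continuous]) auto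

text \<open>The bound is uniform in \<open>t\<close> as well as in \<open>s\<close>, because bounded
  convergence is applied along sequences of times.\<close>

lemma dker_bounded: obtains C where "\<And>t s. 0 \<le> t \<Longrightarrow> \<bar>dker t s\<bar> \<le> C"
proof -
  obtain L where L: "L \<ge> 0" "\<And>t. t \<in> {0..\<tau>R} \<Longrightarrow> \<bar>dg t\<bar> \<le> L"
    by (rule dg_bounded) blast
  show ?thesis
  proof (rule that[of "exp (\<bar>r + \<delta>\<bar> * \<tau>R) * L"])
    fix t s :: real assume t: "0 \<le> t"
    show "\<bar>dker t s\<bar> \<le> exp (\<bar>r + \<delta>\<bar> * \<tau>R) * L"
    proof (cases "s \<in> {0..\<tau>R - t}")
      case True
      then have "\<bar>dker t s\<bar> = exp (- (r + \<delta>) * s) * \<bar>dg (t + s)\<bar>"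
        by (simp add: dker_def abs_mult)
      also have "\<dots> \<le> exp (\<bar>r + \<delta>\<bar> * \<tau>R) * L"
        using True t L by (intro mult_mono exp_bound L(2)) auto
      finally show ?thesis .
    next
      case False
      then have "dker t s = 0" by (simp add: dker_def)
      with L(1) show ?thesis by simp
    qed
  qed
qed

text \<open>With the lag \<open>s = \<zeta> - \<tau>\<close>, the upper limit
  \<open>\<tau> \<le> \<zeta>\<close> and the lower limit \<open>\<zeta> + t - \<tau>R\<close>
  become the support condition \<open>0 \<le> s \<le> \<tau>R - t\<close> of the kernel; the limit
  \<open>-d\<close> is encoded in the cutoff of \<open>\<phi>\<close>.\<close>

lemma h_eq_conv:
  assumes t: "0 \<le> t" and \<zeta>: "\<zeta> \<in> {-d..0}"
  shows "h t \<zeta> = conv \<phi>' (ker t) \<zeta>"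
proof (cases "t < \<tau>R")
  case True
  note m = sq_integrable_measurable[OF sq_integrable_rep[of \<phi>], measurable] ker_measurable[OF t, measurable]
  have "h t \<zeta> = (LBINT \<tau>:{max (\<zeta> + t - \<tau>R) (- d)..\<zeta>}.
      exp (- (r + \<delta>) * (\<zeta> - \<tau>)) * g (t + \<zeta> - \<tau>) * rep_L2fun \<phi> \<tau>)"
    using gh t \<zeta> True unfolding gh_solution_def by simp
  also have "\<dots> = (LBINT \<tau>. indicat_real {-d..0} \<tau> * rep_L2fun \<phi> \<tau> * ker t (\<zeta> - \<tau>))"
    unfolding set_lebesgue_integral_def
    using \<zeta> by (intro Bochner_Integration.integral_cong)
      (auto simp: ker_def indicator_def algebra_simps)
  also have "\<dots> = conv \<phi>' (ker t) \<zeta>"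
    unfolding conv_def
  proof (rule integral_cong_AE)
    \<comment> \<open>The closed interval of the integral equation and the open one in
      \<open>restr\<close> differ by the two points \<open>-d\<close> and 0.\<close>
    show "AE \<tau> in lborel. indicat_real {-d..0} \<tau> * rep_L2fun \<phi> \<tau> * ker t (\<zeta> - \<tau>) = \<phi>' \<tau> * ker t (\<zeta> - \<tau>)"
      using AE_lborel_singleton[of "-d"] AE_lborel_singleton[of "0::real"]
      by eventually_elim (auto simp: restr_def indicator_def)
    show "(\<lambda>\<tau>. indicat_real {-d..0} \<tau> * rep_L2fun \<phi> \<tau> * ker t (\<zeta> - \<tau>)) \<in> borel_measurable lborel"
      by measurable
    show "(\<lambda>\<tau>. \<phi>' \<tau> * ker t (\<zeta> - \<tau>)) \<in> borel_measurable lborel"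
      unfolding restr_def by measurable
  qed
  finally show ?thesis .
next
  case False
  then have "ker t s = 0" for s
    using g_after[of "t + s"] by (auto simp: ker_def indicator_def)
  then show ?thesis using False \<zeta> by (simp add: conv_def h_after)
qed

section \<open>The curve \<open>H\<close> in the history space and its derivatives\<close>

definition H :: "real \<Rightarrow> L2fun" where "H t = to_L2 d (h t)"
definition dH :: "real \<Rightarrow> L2fun" where "dH t = to_L2 d (conv \<phi>' (dker t))"

lemma H_conv: "0 \<le> t \<Longrightarrow> H t = to_L2 d (conv \<phi>' (ker t))"
  unfolding H_def by (intro to_L2_cong h_eq_conv) auto

lemma H_sq_integrable: assumes t: "0 \<le> t" shows "sq_integrable (restr d (h t))"
proof -
  have "restr d (h t) = restr d (conv \<phi>' (ker t))"
    using h_eq_conv[OF t] by (auto simp: restr_def indicator_def fun_eq_iff)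
  then show ?thesis
    using ker_bounded[OF t] sq_integrable_conv[OF \<phi>'_integrable ker_measurable[OF t]] by auto
qed

lemma dH_sq_integrable: "0 \<le> t \<Longrightarrow> sq_integrable (restr d (conv \<phi>' (dker t)))"
  by (rule dker_bounded) (intro sq_integrable_conv \<phi>'_integrable dker_measurable)

lemma H_L2: "0 \<le> t \<Longrightarrow> H t \<in> L2 d"
  unfolding H_def by (intro to_L2_in_L2 H_sq_integrable)

lemma dH_L2: "0 \<le> t \<Longrightarrow> dH t \<in> L2 d"
  unfolding dH_def by (intro to_L2_in_L2 dH_sq_integrable)

text \<open>Along a sequence of times tending to \<open>t\<close>, the kernels converge wherever
  \<open>dg'\<close> is continuous at \<open>t + s\<close>. The jump at \<open>\<tau>R\<close>
  excludes only \<open>s = \<tau>R - t\<close>, which the convolution limit tolerates.\<close>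

lemma dH_continuous: "continuous_on {0..\<tau>R} dH"
  unfolding continuous_on_sequentially
proof safe
  fix X :: "nat \<Rightarrow> real" and t
  assume t: "t \<in> {0..\<tau>R}" and "\<forall>n. X n \<in> {0..\<tau>R}" and X: "X \<longlonglongrightarrow> t"
  then have X0: "0 \<le> X n" for n by simp
  obtain C where C: "\<And>t s. 0 \<le> t \<Longrightarrow> \<bar>dker t s\<bar> \<le> C" by (rule dker_bounded) blast
  have "(\<lambda>n. to_L2 d (conv \<phi>' (dker (X n)))) \<longlonglongrightarrow> to_L2 d (conv \<phi>' (dker t))"
  proof (rule to_L2_conv_tendsto[OF \<phi>'_integrable dker_measurable[OF X0] dker_measurable C[OF X0]])
    show "0 \<le> t" using t by simp
    fix s assume s: "s \<noteq> \<tau>R - t"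
    show "(\<lambda>n. dker (X n) s) \<longlonglongrightarrow> dker t s"
    proof (cases "s \<in> {0..\<tau>R}")
      case True
      have "(\<lambda>n. dg' (X n + s)) \<longlonglongrightarrow> dg' (t + s)"
      proof (rule continuous_within_tendsto_compose'[of "t + s" "{0..}" dg'])
        show "continuous (at (t + s) within {0..}) dg'"
          using True t s by (intro dg'_continuous) auto
        show "(\<lambda>n. X n + s) \<longlonglongrightarrow> t + s" by (intro tendsto_intros X)
      qed (use True X0 in auto)
      then show ?thesis
        using X0 t by (auto simp: dker_alt intro!: tendsto_intros)
    qed (use X0 t in \<open>simp add: dker_alt\<close>)
  qed
  then show "(dH \<circ> X) \<longlonglongrightarrow> dH t"
    by (simp add: dH_def o_def)
qed

text \<open>The difference quotient of \<open>H\<close> is the convolution with the difference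
  quotient of the kernel. The latter is bounded by the Lipschitz constant of \<open>g\<close> and
  converges to \<open>dker t\<close> except at \<open>s = \<tau>R - t\<close>.\<close>

lemma H_has_derivative:
  assumes t: "t \<in> {0..\<tau>R}"
  shows "(H has_vector_derivative dH t) (at t within {0..\<tau>R})"
proof -
  have "((\<lambda>x. (1 / (x - t)) *\<^sub>R H x + (- (1 / (x - t))) *\<^sub>R H t) \<longlongrightarrow> dH t) (at t within {0..\<tau>R})"
    unfolding tendsto_at_iff_sequentially o_def
  proof safe
    fix X :: "nat \<Rightarrow> real"
    assume "\<forall>n. X n \<in> {0..\<tau>R} - {t}" and X: "X \<longlonglongrightarrow> t"
    then have X0: "0 \<le> X n" and Xt: "X n \<noteq> t" for n by auto
    have t0: "0 \<le> t" using t by simp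
    obtain L where L: "\<And>s t. 0 \<le> s \<Longrightarrow> 0 \<le> t \<Longrightarrow> \<bar>g s - g t\<bar> \<le> L * \<bar>s - t\<bar>"
      by (rule g_lipschitz) blast
    define q where "q n s = 1 / (X n - t) * ker (X n) s + (- (1 / (X n - t))) * ker t s" for n s
    have q_eq: "q n s = indicat_real {0..\<tau>R} s * (exp (- (r + \<delta>) * s) * ((g (X n + s) - g (t + s)) / (X n - t)))"
      for n s
      unfolding q_def ker_alt[OF X0] ker_alt[OF t0] by (simp add: diff_divide_distrib algebra_simps)
    have "(\<lambda>n. to_L2 d (conv \<phi>' (q n))) \<longlonglongrightarrow> to_L2 d (conv \<phi>' (dker t))"
    proof (rule to_L2_conv_tendsto[OF \<phi>'_integrable _ dker_measurable[OF t0]])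
      show "q n \<in> borel_measurable borel" for n
        unfolding q_def[abs_def] using ker_measurable[OF X0] ker_measurable[OF t0] by measurable
      show "\<bar>q n s\<bar> \<le> exp (\<bar>r + \<delta>\<bar> * \<tau>R) * \<bar>L\<bar>" for n s
      proof (cases "s \<in> {0..\<tau>R}")
        case True
        have "\<bar>g (X n + s) - g (t + s)\<bar> \<le> L * \<bar>X n - t\<bar>"
          using L[of "X n + s" "t + s"] True X0 t0 by simp
        also have "\<dots> \<le> \<bar>L\<bar> * \<bar>X n - t\<bar>" by (intro mult_right_mono) auto
        finally have "\<bar>(g (X n + s) - g (t + s)) / (X n - t)\<bar> \<le> \<bar>L\<bar>"
          using Xt[of n] by (simp add: abs_divide divide_le_eq)
        moreover have "\<bar>q n s\<bar> = exp (- (r + \<delta>) * s) * \<bar>(g (X n + s) - g (t + s)) / (X n - t)\<bar>"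
          using True by (simp add: q_eq abs_mult)
        ultimately show ?thesis
          using exp_bound[OF True] by (simp only:) (intro mult_mono; simp)
      qed (simp add: q_eq)
      fix s assume s: "s \<noteq> \<tau>R - t"
      show "(\<lambda>n. q n s) \<longlonglongrightarrow> dker t s"
      proof (cases "s \<in> {0..\<tau>R}")
        case True
        have "(g has_real_derivative dg' (t + s)) (at (t + s) within {0..})"
          using True t s by (intro g_has_derivative') auto
        then have "((\<lambda>y. (g y - g (t + s)) / (y - (t + s))) \<longlongrightarrow> dg' (t + s)) (at (t + s) within {0..})"
          by (simp add: has_field_derivative_iff)
        moreover have "filterlim (\<lambda>n. X n + s) (at (t + s) within {0..}) sequentially"
          unfolding filterlim_at using Xt X0 True X by (auto intro!: tendsto_intros)
        ultimately have "(\<lambda>n. (g (X n + s) - g (t + s)) / (X n + s - (t + s))) \<longlonglongrightarrow> dg' (t + s)"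
          by (rule filterlim_compose)
        then have "(\<lambda>n. (g (X n + s) - g (t + s)) / (X n - t)) \<longlonglongrightarrow> dg' (t + s)"
          by (simp add: algebra_simps)
        then show ?thesis
          unfolding q_eq dker_alt[OF t0] by (intro tendsto_intros)
      qed (use t0 in \<open>simp add: dker_alt q_eq\<close>)
    qed
    moreover have "to_L2 d (conv \<phi>' (q n)) = (1 / (X n - t)) *\<^sub>R H (X n) + (- (1 / (X n - t))) *\<^sub>R H t" for n
    proof -
      obtain C C' where "\<And>s. \<bar>ker (X n) s\<bar> \<le> C" "\<And>s. \<bar>ker t s\<bar> \<le> C'"
        using ker_bounded[OF X0] ker_bounded[OF t0] by blast
      then show ?thesis
        unfolding q_def[abs_def] H_conv[OF X0] H_conv[OF t0]
        by (intro to_L2_conv_lincomb \<phi>'_integrable ker_measurable X0 t0)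
    qed
    ultimately show "(\<lambda>n. (1 / (X n - t)) *\<^sub>R H (X n) + (- (1 / (X n - t))) *\<^sub>R H t) \<longlonglongrightarrow> dH t"
      by (simp add: dH_def)
  qed
  from tendsto_norm_zero[OF LIM_zero[OF this]]
  have "((\<lambda>x. norm (H x - H t - (x - t) *\<^sub>R dH t) / norm (x - t)) \<longlongrightarrow> 0) (at t within {0..\<tau>R})"
  proof (rule Lim_transform_eventually)
    show "eventually (\<lambda>x. norm ((1 / (x - t)) *\<^sub>R H x + (- (1 / (x - t))) *\<^sub>R H t - dH t)
        = norm (H x - H t - (x - t) *\<^sub>R dH t) / norm (x - t)) (at t within {0..\<tau>R})"
      unfolding eventually_at_filter
    proof (intro always_eventually allI impI)
      fix x assume "x \<noteq> t"
      then have "(1 / (x - t)) *\<^sub>R H x + (- (1 / (x - t))) *\<^sub>R H t - dH t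
          = (1 / (x - t)) *\<^sub>R (H x - H t - (x - t) *\<^sub>R dH t)"
        by (simp add: scaleR_diff_right)
      then show "norm ((1 / (x - t)) *\<^sub>R H x + (- (1 / (x - t))) *\<^sub>R H t - dH t)
          = norm (H x - H t - (x - t) *\<^sub>R dH t) / norm (x - t)"
        by simp
    qed
  qed
  then show ?thesis
    by (auto simp: has_vector_derivative_def has_derivative_iff_norm intro!: bounded_linear_scaleR_left)
qed

text \<open>On its support the kernel has derivative \<open>dker t - (r + \<delta>) * ker t\<close>;
  its jump at 0 is \<open>g t\<close>, and it ends at \<open>g \<tau>R = 0\<close>. Thus
  \<open>weak_deriv_conv\<close> yields the transport equation in weak form.\<close>

lemma weak_deriv_H:
  assumes t: "t \<in> {0..\<tau>R}"
  shows "weak_deriv d (H t) (g t *\<^sub>R \<phi> + dH t - (r + \<delta>) *\<^sub>R H t)"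
proof -
  have t0: "0 \<le> t" using t by simp
  define \<kappa> where "\<kappa> s = exp (- (r + \<delta>) * s) * g (t + s)" for s
  define \<kappa>' where "\<kappa>' s = exp (- (r + \<delta>) * s) * dg (t + s) + (- (r + \<delta>)) * (exp (- (r + \<delta>) * s) * g (t + s))" for s
  obtain C where C: "\<And>s. \<bar>ker t s\<bar> \<le> C" using ker_bounded[OF t0] by blast
  obtain C' where C': "\<And>t s. 0 \<le> t \<Longrightarrow> \<bar>dker t s\<bar> \<le> C'" by (rule dker_bounded) blast
  have "weak_deriv d (to_L2 d (conv \<phi>' (\<lambda>s. indicat_real {0..\<tau>R - t} s * \<kappa> s)))
      (\<kappa> 0 *\<^sub>R to_L2 d (rep_L2fun \<phi>) + to_L2 d (conv \<phi>' (\<lambda>s. indicat_real {0..\<tau>R - t} s * \<kappa>' s)))"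
  proof (rule weak_deriv_conv[where \<kappa>=\<kappa> and \<kappa>'=\<kappa>' and T="\<tau>R - t"])
    show "(\<kappa> has_real_derivative \<kappa>' s) (at s within {0..\<tau>R - t})" if s: "s \<in> {0..\<tau>R - t}" for s
    proof -
      have "((\<lambda>s. g (t + s)) has_real_derivative dg (t + s) * 1) (at s within {0..\<tau>R - t})"
      proof (rule DERIV_image_chain[of g _ "\<lambda>s. t + s", unfolded o_def])
        show "((\<lambda>s. t + s) has_real_derivative 1) (at s within {0..\<tau>R - t})"
          by (auto intro!: derivative_eq_intros)
        have "(g has_real_derivative dg (t + s)) (at (t + s) within {0..\<tau>R})"
          using s t by (intro g_has_derivative) auto
        then show "(g has_real_derivative dg (t + s)) (at (t + s) within (\<lambda>s. t + s) ` {0..\<tau>R - t})"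
          by (rule has_field_derivative_subset) (use t in auto)
      qed
      then show ?thesis
        unfolding \<kappa>_def[abs_def] \<kappa>'_def by (auto intro!: derivative_eq_intros simp: algebra_simps)
    qed
    show "continuous_on {0..\<tau>R - t} \<kappa>'"
      unfolding \<kappa>'_def[abs_def] using t0
      by (intro continuous_intros continuous_on_compose2[OF g_continuous] continuous_on_compose2[OF dg_continuous]) auto
  qed (use t in \<open>auto simp: \<kappa>_def g_after intro: to_L2_rep \<phi>_L2\<close>)
  also have "(\<lambda>s. indicat_real {0..\<tau>R - t} s * \<kappa>' s) = (\<lambda>s. 1 * dker t s + (- (r + \<delta>)) * ker t s)"
    by (auto simp: \<kappa>'_def dker_def ker_def algebra_simps)
  also have "to_L2 d (conv \<phi>' \<dots>) = 1 *\<^sub>R dH t + (- (r + \<delta>)) *\<^sub>R H t"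
    unfolding H_conv[OF t0] dH_def
    by (rule to_L2_conv_lincomb[OF \<phi>'_integrable dker_measurable[OF t0] C'[OF t0] ker_measurable[OF t0] C])
  also have "\<dots> = dH t - (r + \<delta>) *\<^sub>R H t"
    by (simp add: algebra_simps)
  finally show ?thesis
    by (simp add: add_diff_eq H_conv[OF t0] ker_def[abs_def] \<kappa>_def[abs_def] to_L2_rep(2)[OF \<phi>_L2])
qed

text \<open>The gradient of the candidate is a multiple of \<open>(g t, H t)\<close>. In the second
  component of \<open>Astar\<close> the term \<open>g t *\<^sub>R \<phi>\<close> cancels against the
  weak derivative, which leaves an expression continuous in time.\<close>

lemma grad_dom_Astar:
  assumes t: "t \<in> {0..\<tau>R}"
  shows "c *\<^sub>R (g t, H t) \<in> dom_Astar d"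
    and "Astar d \<mu>y \<phi> (c *\<^sub>R (g t, H t)) = c *\<^sub>R (\<mu>y * g t + h t 0, (r + \<delta>) *\<^sub>R H t - dH t)"
proof -
  have t0: "0 \<le> t" using t by simp
  let ?D = "g t *\<^sub>R \<phi> + dH t - (r + \<delta>) *\<^sub>R H t"
  have D: "?D \<in> L2 d"
    by (intro subspace_add subspace_diff subspace_scale L2_subspace H_L2 dH_L2 t0 \<phi>_L2)
  have wd: "weak_deriv d (c *\<^sub>R H t) (c *\<^sub>R ?D)"
    by (intro weak_deriv_scaleR H_L2 t0 D weak_deriv_H t)
  have in_L2: "c *\<^sub>R H t \<in> L2 d" "c *\<^sub>R ?D \<in> L2 d"
    by (intro subspace_scale L2_subspace H_L2 t0 D)+
  have eq: "c *\<^sub>R H t = to_L2 d (\<lambda>s. c * h t s)"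
    unfolding H_def by (rule to_L2_scale[symmetric, OF H_sq_integrable[OF t0]])
  have val: "cont_value d (c *\<^sub>R H t) s = c * h t s" if "s \<in> {-d..0}" for s
    unfolding eq using that d_pos
    by (subst cont_value_to_L2)
       (auto intro!: continuous_intros h_continuous_snd[OF t0] sq_integrable_restr_scale H_sq_integrable t0)
  show "c *\<^sub>R (g t, H t) \<in> dom_Astar d"
    using wd in_L2 val[of "-d"] d_pos h_left_end[OF t0] by (auto simp: dom_Astar_def W12_def)
  show "Astar d \<mu>y \<phi> (c *\<^sub>R (g t, H t)) = c *\<^sub>R (\<mu>y * g t + h t 0, (r + \<delta>) *\<^sub>R H t - dH t)"
    using val[of 0] d_pos wderiv_eqI[OF d_pos in_L2 wd] by (simp add: Astar_def algebra_simps)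
qed

end

section \<open>The maximized Hamiltonian\<close>

text \<open>Concavity: the marginal utility \<open>c powr - \<gamma>\<close> decreases, so the mean
  value theorem puts the graph below its tangent at \<open>c0\<close>. Summed tangent bounds later
  turn the maximization over consumption and bequest into a linear problem.\<close>

lemma crra_le_tangent:
  assumes \<gamma>: "\<gamma> > 0" "\<gamma> \<noteq> 1" and c: "c \<ge> 0" and c0: "c0 > 0"
  shows "crra \<gamma> c \<le> ereal (c0 powr (1 - \<gamma>) / (1 - \<gamma>) + c0 powr - \<gamma> * (c - c0))"
proof (cases "c = 0")
  case True
  \<comment> \<open>At zero the tangent has value
    \<open>\<gamma> / (1 - \<gamma>) * c0 powr (1 - \<gamma>)\<close>, which is positive for
    \<open>\<gamma> < 1\<close>, where the utility is 0; for \<open>\<gamma> > 1\<close> the utility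
    is minus infinity.\<close>
  have "c0 powr - \<gamma> * c0 = c0 powr (1 - \<gamma>)"
    using c0 by (simp add: powr_mult_base ac_simps)
  then have "c0 powr (1 - \<gamma>) / (1 - \<gamma>) + c0 powr - \<gamma> * (c - c0) = \<gamma> / (1 - \<gamma>) * c0 powr (1 - \<gamma>)"
    using \<gamma> True by (simp add: field_simps)
  then show ?thesis using \<gamma> True by (auto simp: crra_def)
next
  case False
  then have c: "c > 0" using c by simp
  let ?u = "\<lambda>x. x powr (1 - \<gamma>) / (1 - \<gamma>)"
  have der: "(?u has_real_derivative x powr - \<gamma>) (at x)" if "x > 0" for x
    using that \<gamma> by (auto intro!: derivative_eq_intros)
  have "?u c \<le> ?u c0 + c0 powr - \<gamma> * (c - c0)"
  proof (cases c c0 rule: linorder_cases)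
    case less
    obtain z where z: "c < z" "z < c0" "?u c0 - ?u c = (c0 - c) * z powr - \<gamma>"
      using MVT2[OF less der] c by force
    have "c0 powr - \<gamma> * (c0 - c) \<le> (c0 - c) * z powr - \<gamma>"
      unfolding mult.commute[of "c0 - c"] using z c \<gamma> by (intro mult_right_mono powr_mono2') auto
    then show ?thesis using z(3) by (simp add: algebra_simps)
  next
    case greater
    obtain z where z: "c0 < z" "z < c" "?u c - ?u c0 = (c - c0) * z powr - \<gamma>"
      using MVT2[OF greater der] c0 by force
    have "(c - c0) * z powr - \<gamma> \<le> c0 powr - \<gamma> * (c - c0)"
      unfolding mult.commute[of "c - c0"] using z c0 \<gamma> by (intro mult_right_mono powr_mono2') auto
    then show ?thesis using z(3) by simp
  qed simp
  then show ?thesis using False by (simp add: crra_def)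
qed

lemma matrix_inv_mult:
  assumes "invertible A"
  shows "A ** matrix_inv A = mat 1" "matrix_inv A ** A = mat 1"
  using someI_ex[OF assms[unfolded invertible_def]] unfolding matrix_inv_def by blast+

text \<open>The maximization separates. The hypotheses on \<open>c0\<close> and \<open>B0\<close>
  are the first-order conditions for consumption and bequest, and the portfolio part is a strictly
  concave quadratic in \<open>transpose \<sigma> *v \<theta>\<close>, settled by completing the
  square. Invertibility of \<open>\<sigma>\<close> makes its vertex attainable.\<close>

lemma Ham_max_eq:
  fixes \<mu> \<sigma>y \<kappa> :: "real^'n" and \<sigma> :: "real^'n^'n" and x0 p0 P12 :: real
  assumes \<sigma>: "invertible \<sigma>" and \<kappa>: "\<sigma> *v \<kappa> = \<mu> - r *\<^sub>R (\<chi> i. 1)"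
    and \<delta>: "\<delta> > 0" and \<gamma>: "\<gamma> > 0" "\<gamma> \<noteq> 1" and P11: "P11 < 0"
    and c0: "c0 > 0" "exp (- (\<rho> + \<delta>) * t) * c0 powr - \<gamma> = p0"
    and B0: "B0 > 0" "exp (- (\<rho> + \<delta>) * t) * (k powr (1 - \<gamma>) * B0 powr - \<gamma>) = p0"
  defines "q \<equiv> p0 *\<^sub>R \<kappa> + (x0 * P12) *\<^sub>R \<sigma>y"
  shows "Ham_max r \<mu> \<sigma> \<sigma>y \<delta> \<rho> k \<gamma> t x0 p0 P11 P12
    = ereal (\<gamma> / (1 - \<gamma>) * p0 * (c0 + \<delta> * B0) - inner q q / (2 * P11))"
proof -
  define e where "e = exp (- (\<rho> + \<delta>) * t)"
  have e: "e > 0" by (simp add: e_def)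
  have lin: "inner \<theta> (\<sigma> *v y) = inner (transpose \<sigma> *v \<theta>) y" for \<theta> y
    by (simp add: dot_lmul_matrix)
  have risk: "(inner \<theta> (\<mu> - r *\<^sub>R (\<chi> i. 1)) - c - \<delta> * B) * p0
      + 1 / 2 * inner \<theta> ((\<sigma> ** transpose \<sigma>) *v \<theta>) * P11 + inner \<theta> (\<sigma> *v \<sigma>y) * x0 * P12
    = - (c + \<delta> * B) * p0 + (inner y q + 1 / 2 * inner y y * P11)"
    if "y = transpose \<sigma> *v \<theta>" for \<theta> y c B
    unfolding \<kappa>[symmetric] matrix_vector_mul_assoc[symmetric] lin that[symmetric] q_def
    by (simp add: inner_right_distrib algebra_simps)
  have square: "inner y q + 1 / 2 * inner y y * P11
      = - inner q q / (2 * P11) + 1 / 2 * P11 * inner (y + (1 / P11) *\<^sub>R q) (y + (1 / P11) *\<^sub>R q)" for y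
    using P11 by (simp add: inner_simps inner_commute field_simps power2_eq_square)
  \<comment> \<open>By the first-order conditions the discounted tangent bound has slope
    \<open>p0\<close> in \<open>c\<close> and \<open>\<delta> * p0\<close> in \<open>B\<close>,
    exactly opposite to the cost \<open>- (c + \<delta> * B) * p0\<close>.\<close>
  have util: "e * (c0 powr (1 - \<gamma>) / (1 - \<gamma>) + c0 powr - \<gamma> * (c - c0)
      + \<delta> * k powr (1 - \<gamma>) * (B0 powr (1 - \<gamma>) / (1 - \<gamma>) + B0 powr - \<gamma> * (B - B0)))
    = \<gamma> / (1 - \<gamma>) * p0 * (c0 + \<delta> * B0) + (c + \<delta> * B) * p0" for c B
  proof -
    have 1: "c0 powr (1 - \<gamma>) = c0 * c0 powr - \<gamma>" "B0 powr (1 - \<gamma>) = B0 * B0 powr - \<gamma>"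
      using c0(1) B0(1) by (simp_all add: powr_mult_base)
    define C D where "C = c0 powr - \<gamma>" and "D = B0 powr - \<gamma>"
    have "e * (c0 * C / (1 - \<gamma>) + C * (c - c0)
        + \<delta> * k powr (1 - \<gamma>) * (B0 * D / (1 - \<gamma>) + D * (B - B0)))
      = (e * C) * (c0 / (1 - \<gamma>) + (c - c0)) + \<delta> * (e * (k powr (1 - \<gamma>) * D)) * (B0 / (1 - \<gamma>) + (B - B0))"
      by (simp add: algebra_simps)
    also have "\<dots> = p0 * (c0 / (1 - \<gamma>) + (c - c0)) + \<delta> * p0 * (B0 / (1 - \<gamma>) + (B - B0))"
      using c0(2) B0(2) by (simp add: e_def C_def D_def)
    also have "\<dots> = \<gamma> / (1 - \<gamma>) * p0 * (c0 + \<delta> * B0) + (c + \<delta> * B) * p0"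
    proof -
      have frac: "X / (1 - \<gamma>) = X + \<gamma> / (1 - \<gamma>) * X" for X
        using \<gamma> by (simp add: field_simps)
      show ?thesis unfolding frac[of c0] frac[of B0] by (simp add: algebra_simps add_divide_distrib)
    qed
    finally show ?thesis unfolding 1 C_def D_def .
  qed
  define J where "J c B \<theta> = ereal e * (crra \<gamma> c + ereal (\<delta> * k powr (1 - \<gamma>)) * crra \<gamma> B)
    + ereal ((inner \<theta> (\<mu> - r *\<^sub>R (\<chi> i. 1)) - c - \<delta> * B) * p0
      + 1 / 2 * inner \<theta> ((\<sigma> ** transpose \<sigma>) *v \<theta>) * P11 + inner \<theta> (\<sigma> *v \<sigma>y) * x0 * P12)"
    for c B \<theta>
  have upper: "J c B \<theta> \<le> ereal (\<gamma> / (1 - \<gamma>) * p0 * (c0 + \<delta> * B0) - inner q q / (2 * P11))"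
    if nn: "0 \<le> c" "0 \<le> B" for c B \<theta>
  proof -
    define y where "y = transpose \<sigma> *v \<theta>"
    have "ereal e * (crra \<gamma> c + ereal (\<delta> * k powr (1 - \<gamma>)) * crra \<gamma> B)
      \<le> ereal e * (ereal (c0 powr (1 - \<gamma>) / (1 - \<gamma>) + c0 powr - \<gamma> * (c - c0))
        + ereal (\<delta> * k powr (1 - \<gamma>)) * ereal (B0 powr (1 - \<gamma>) / (1 - \<gamma>) + B0 powr - \<gamma> * (B - B0)))"
      using \<delta> e by (intro ereal_mult_left_mono add_mono crra_le_tangent \<gamma> nn c0 B0) auto
    also have "\<dots> = ereal (\<gamma> / (1 - \<gamma>) * p0 * (c0 + \<delta> * B0) + (c + \<delta> * B) * p0)"
      using util[of c B] by simp
    finally have le: "ereal e * (crra \<gamma> c + ereal (\<delta> * k powr (1 - \<gamma>)) * crra \<gamma> B)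
      \<le> ereal (\<gamma> / (1 - \<gamma>) * p0 * (c0 + \<delta> * B0) + (c + \<delta> * B) * p0)" .
    have "1 / 2 * P11 * inner (y + (1 / P11) *\<^sub>R q) (y + (1 / P11) *\<^sub>R q) \<le> 0"
      by (rule mult_nonpos_nonneg) (use P11 in auto)
    then have "- (c + \<delta> * B) * p0 + (inner y q + 1 / 2 * inner y y * P11)
        \<le> - (c + \<delta> * B) * p0 - inner q q / (2 * P11)"
      unfolding square by simp
    then have "J c B \<theta> \<le> ereal (\<gamma> / (1 - \<gamma>) * p0 * (c0 + \<delta> * B0) + (c + \<delta> * B) * p0)
        + ereal (- (c + \<delta> * B) * p0 - inner q q / (2 * P11))"
      unfolding J_def risk[OF y_def] by (intro add_mono le) (simp only: ereal_less_eq)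
    then show ?thesis by (simp add: algebra_simps)
  qed
  \<comment> \<open>This is the vertex of the quadratic, where the square vanishes;
    \<open>\<theta>\<close> is its preimage under the transpose of \<open>\<sigma>\<close>.\<close>
  define y where "y = - ((1 / P11) *\<^sub>R q)"
  define \<theta> where "\<theta> = transpose (matrix_inv \<sigma>) *v y"
  have y: "y = transpose \<sigma> *v \<theta>"
    unfolding \<theta>_def matrix_vector_mul_assoc matrix_transpose_mul[symmetric] matrix_inv_mult(2)[OF \<sigma>]
    by (simp add: transpose_mat)
  have "- (c0 + \<delta> * B0) * p0 + (inner y q + 1 / 2 * inner y y * P11)
      = - (c0 + \<delta> * B0) * p0 - inner q q / (2 * P11)"
    unfolding square by (simp add: y_def)
  then have attained: "J c0 B0 \<theta> = ereal (\<gamma> / (1 - \<gamma>) * p0 * (c0 + \<delta> * B0) - inner q q / (2 * P11))"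
    unfolding J_def risk[OF y] using util[of c0 B0] c0(1) B0(1)
    by (simp add: crra_def algebra_simps)
  have "Ham_max r \<mu> \<sigma> \<sigma>y \<delta> \<rho> k \<gamma> t x0 p0 P11 P12
      = (SUP (c, B, \<theta>) \<in> {0..} \<times> {0..} \<times> UNIV. J c B \<theta>)"
    by (simp add: Ham_max_def J_def e_def)
  also have "\<dots> = J c0 B0 \<theta>"
  proof (rule antisym)
    show "(SUP (c, B, \<theta>) \<in> {0..} \<times> {0..} \<times> UNIV. J c B \<theta>) \<le> J c0 B0 \<theta>"
      unfolding attained by (rule SUP_least) (clarify, rule upper, simp_all)
    show "J c0 B0 \<theta> \<le> (SUP (c, B, \<theta>) \<in> {0..} \<times> {0..} \<times> UNIV. J c B \<theta>)"
      by (rule SUP_upper2[of "(c0, B0, \<theta>)"]) (use c0 B0 in auto)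
  qed
  finally show ?thesis by (simp only: attained)
qed

section \<open>Regularity of the candidate value function\<close>

context annuity
begin

lemma Gam_eq: "Gam d g h (t, w, x0, x1) = w + g t * x0 + inner (H t) x1"
  by (simp add: Gam_def H_def)

abbreviation U :: "(real \<times> real \<times> real \<times> L2fun) set" where "U \<equiv> Hpp d \<tau>R g h"

lemma U_fst: "p \<in> U \<Longrightarrow> fst p \<in> {0..\<tau>R}" and U_pos: "p \<in> U \<Longrightarrow> 0 < Gam d g h p"
  by (auto simp: Hpp_def)

lemma continuous_on_U_fst:
  fixes q :: "real \<Rightarrow> 'a::topological_space"
  assumes "continuous_on {0..\<tau>R} q"
  shows "continuous_on U (\<lambda>p. q (fst p))"
  by (rule continuous_on_compose2[OF assms]) (use U_fst in \<open>auto intro!: continuous_intros\<close>)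

lemma H_continuous: "continuous_on {0..\<tau>R} H"
  unfolding continuous_on_eq_continuous_within
  using H_has_derivative by (blast intro: has_vector_derivative_continuous)

lemmas U_continuous_intros =
  continuous_on_U_fst[OF H_continuous] continuous_on_U_fst[OF dH_continuous]
  continuous_on_U_fst[OF continuous_on_subset[OF g_continuous]]
  continuous_on_U_fst[OF continuous_on_subset[OF dg_continuous]]
  continuous_on_U_fst[OF continuous_on_subset[OF h_continuous_fst]]

lemma Gam_eq': "Gam d g h = (\<lambda>p. fst (snd p) + g (fst p) * fst (snd (snd p)) + inner (H (fst p)) (snd (snd (snd p))))"
  by (auto simp: Gam_eq)

lemma Gam_continuous: "continuous_on U (Gam d g h)"
  unfolding Gam_eq' by (intro continuous_intros U_continuous_intros) auto

text \<open>The history enters through an inner product, so norm differentiability of the curve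
  \<open>H\<close> and the product rule give joint differentiability in time and state.\<close>

lemma Gam_has_derivative:
  assumes p: "(t, w, x0, x1) \<in> U"
  shows "(Gam d g h has_derivative (\<lambda>(s, \<omega>, \<xi>0, \<xi>1).
    (dg t * x0 + inner (dH t) x1) * s + \<omega> + g t * \<xi>0 + inner (H t) \<xi>1)) (at (t, w, x0, x1) within U)"
proof -
  have t: "t \<in> {0..\<tau>R}" using U_fst[OF p] by simp
  have fst_U: "fst ` U \<subseteq> {0..\<tau>R}" using U_fst by auto
  have "(g has_derivative (\<lambda>s. s * dg t)) (at (fst (t, w, x0, x1)) within fst ` U)"
    using has_derivative_subset[OF g_has_derivative[OF t, unfolded has_field_derivative_def] fst_U]
    by (simp add: mult_commute_abs)
  from has_derivative_in_compose[OF bounded_linear_imp_has_derivative[OF bounded_linear_fst] this]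
  have dg: "((\<lambda>p. g (fst p)) has_derivative (\<lambda>q. fst q * dg t)) (at (t, w, x0, x1) within U)" .
  have "(H has_derivative (\<lambda>s. s *\<^sub>R dH t)) (at (fst (t, w, x0, x1)) within fst ` U)"
    using has_derivative_subset[OF H_has_derivative[OF t, unfolded has_vector_derivative_def] fst_U]
    by simp
  from has_derivative_in_compose[OF bounded_linear_imp_has_derivative[OF bounded_linear_fst] this]
  have dH: "((\<lambda>p. H (fst p)) has_derivative (\<lambda>q. fst q *\<^sub>R dH t)) (at (t, w, x0, x1) within U)" .
  show ?thesis
    unfolding Gam_eq'
    by (rule derivative_eq_intros dg dH refl)+ (auto simp: algebra_simps fun_eq_iff)
qed

text \<open>Separates calculus from algebra: for a time factor \<open>Q\<close> times a power
  utility of \<open>Gam\<close>, all derivatives and their continuity follow from the chain rule,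
  and only a pointwise identity and the terminal value remain to be checked.\<close>

lemma classical_solutionI:
  assumes \<gamma>: "\<gamma> \<noteq> 1"
    and Q: "\<And>t. t \<in> {0..\<tau>R} \<Longrightarrow> (Q has_real_derivative Q' t) (at t within {0..\<tau>R})"
    and Q': "continuous_on {0..\<tau>R} Q'"
    and hjb: "\<And>t w x0 x1 G. (t, w, x0, x1) \<in> U \<Longrightarrow> G = w + g t * x0 + inner (H t) x1 \<Longrightarrow> 0 < G \<Longrightarrow>
      ereal (- (Q' t * (G powr (1 - \<gamma>) / (1 - \<gamma>)) + Q t * G powr - \<gamma> * (dg t * x0 + inner (dH t) x1)))
      = HH (t, w, x0, x1) (Q t * G powr - \<gamma>, (Q t * G powr - \<gamma>) *\<^sub>R (g t, H t))
          (- \<gamma> * Q t * G powr (- \<gamma> - 1), - \<gamma> * Q t * G powr (- \<gamma> - 1) * g t, - \<gamma> * Q t * G powr (- \<gamma> - 1) * (g t)\<^sup>2)"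
    and terminal: "\<And>w x. (\<tau>R, w, x) \<in> U \<Longrightarrow> Q \<tau>R * (w powr (1 - \<gamma>) / (1 - \<gamma>)) = vT (w, x)"
  shows "classical_solution d (Astar d \<mu>y \<phi>) \<tau>R U HH vT
    (\<lambda>p. Q (fst p) * (Gam d g h p powr (1 - \<gamma>) / (1 - \<gamma>)))"
proof -
  let ?G = "Gam d g h"
  define vw where "vw p = Q (fst p) * ?G p powr - \<gamma>" for p
  define vt where "vt p = Q' (fst p) * (?G p powr (1 - \<gamma>) / (1 - \<gamma>))
    + vw p * (dg (fst p) * fst (snd (snd p)) + inner (dH (fst p)) (snd (snd (snd p))))" for p
  define vx where "vx p = vw p *\<^sub>R (g (fst p), H (fst p))" for p
  define vww where "vww p = - \<gamma> * Q (fst p) * ?G p powr (- \<gamma> - 1)" for p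
  define vwx where "vwx p = vww p * g (fst p)" for p
  define vxx where "vxx p = vww p * (g (fst p))\<^sup>2" for p
  have Q_cont: "continuous_on {0..\<tau>R} Q"
    using Q by (rule DERIV_continuous_on)
  have powr_cont: "continuous_on U (\<lambda>p. ?G p powr a)" for a
    by (intro continuous_intros Gam_continuous) (use U_pos in force)
  note cont = powr_cont continuous_on_U_fst[OF Q_cont] continuous_on_U_fst[OF Q'] U_continuous_intros
  have vw_cont: "continuous_on U vw"
    unfolding vw_def[abs_def] by (intro continuous_intros cont)
  have vt_cont: "continuous_on U vt"
    unfolding vt_def[abs_def] using \<gamma> by (intro continuous_intros cont vw_cont) auto
  have vx_cont: "continuous_on U vx"
    unfolding vx_def[abs_def] by (intro continuous_intros cont vw_cont) auto
  have vww_cont: "continuous_on U vww"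
    unfolding vww_def[abs_def] by (intro continuous_intros cont)
  have vwx_cont: "continuous_on U vwx"
    unfolding vwx_def[abs_def] by (intro continuous_intros cont vww_cont) auto
  have vxx_cont: "continuous_on U vxx"
    unfolding vxx_def[abs_def] by (intro continuous_intros cont vww_cont) auto
  have Astar_cont: "continuous_on U (\<lambda>p. Astar d \<mu>y \<phi> (vx p))"
  proof -
    have "continuous_on U (\<lambda>p. vw p *\<^sub>R (\<mu>y * g (fst p) + h (fst p) 0, (r + \<delta>) *\<^sub>R H (fst p) - dH (fst p)))"
      using d_pos by (intro continuous_intros cont vw_cont) auto
    then show ?thesis
      by (rule continuous_on_eq) (simp only: vx_def grad_dom_Astar(2)[OF U_fst])
  qed
  have dom: "vx p \<in> dom_Astar d" if "p \<in> U" for p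
    unfolding vx_def by (rule grad_dom_Astar(1)[OF U_fst[OF that]])
  have vx_M2: "vx p \<in> M2 d" if "p \<in> U" for p
    using H_L2[of "fst p"] U_fst[OF that] subspace_scale[OF L2_subspace] by (auto simp: vx_def M2_def)
  have der: "((\<lambda>p. Q (fst p) * (?G p powr (1 - \<gamma>) / (1 - \<gamma>))) has_derivative
      (\<lambda>(s, \<omega>, \<xi>). vt p * s + vw p * \<omega> + inner (vx p) \<xi>)) (at p within U)" if p: "p \<in> U" for p
  proof -
    obtain t w x0 x1 where peq: "p = (t, w, x0, x1)" by (cases p)
    have t: "t \<in> {0..\<tau>R}" using U_fst[OF p] peq by simp
    have fst_U: "fst ` U \<subseteq> {0..\<tau>R}" using U_fst by auto
    have "(Q has_derivative (\<lambda>s. s * Q' t)) (at (fst p) within fst ` U)"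
      using has_derivative_subset[OF Q[OF t, unfolded has_field_derivative_def] fst_U]
      by (simp add: peq mult_commute_abs)
    from has_derivative_in_compose[OF bounded_linear_imp_has_derivative[OF bounded_linear_fst] this]
    have dQ: "((\<lambda>p. Q (fst p)) has_derivative (\<lambda>q. fst q * Q' t)) (at p within U)" .
    have "((\<lambda>y. y powr (1 - \<gamma>) / (1 - \<gamma>)) has_real_derivative ?G p powr - \<gamma>) (at (?G p))"
      using U_pos[OF p] \<gamma> by (auto intro!: derivative_eq_intros)
    from DERIV_compose_FDERIV[OF this Gam_has_derivative[OF p[unfolded peq], folded peq]]
    have du: "((\<lambda>p. ?G p powr (1 - \<gamma>) / (1 - \<gamma>)) has_derivative
      (\<lambda>q. (case q of (s, \<omega>, \<xi>0, \<xi>1) \<Rightarrow>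
        (dg t * x0 + inner (dH t) x1) * s + \<omega> + g t * \<xi>0 + inner (H t) \<xi>1) * ?G p powr - \<gamma>)) (at p within U)" .
    show ?thesis
      by (rule has_derivative_eq_rhs[OF has_derivative_mult[OF dQ du]])
         (auto simp: peq vt_def vw_def vx_def fun_eq_iff algebra_simps)
  qed
  have hess: "((\<lambda>(w', x0'). (vw (t, w', x0', x1), fst (vx (t, w', x0', x1)))) has_derivative
         (\<lambda>(\<omega>, \<xi>0). (vww (t, w, x0, x1) * \<omega> + vwx (t, w, x0, x1) * \<xi>0,
                      vwx (t, w, x0, x1) * \<omega> + vxx (t, w, x0, x1) * \<xi>0)))
        (at (w, x0) within S)" if p: "(t, w, x0, x1) \<in> U" for t w x0 x1 S
  proof -
    \<comment> \<open>With \<open>t\<close> and \<open>x1\<close> frozen, \<open>Gam\<close> is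
      affine in the remaining pair, so the Hessian is a scalar times the outer square of
      \<open>(1, g t)\<close>, and the differentiation holds within any set
      \<open>S\<close>.\<close>
    define Z where "Z q = fst q + g t * snd q + inner (H t) x1" for q :: "real \<times> real"
    have Z: "?G (t, w', x0', x1) = Z (w', x0')" for w' x0'
      by (simp add: Gam_eq Z_def)
    have "Z (w, x0) > 0" using U_pos[OF p] by (simp add: Z)
    then have 1: "((\<lambda>y. Q t * y powr - \<gamma>) has_real_derivative - \<gamma> * Q t * Z (w, x0) powr (- \<gamma> - 1)) (at (Z (w, x0)))"
      by (auto intro!: derivative_eq_intros)
    have 2: "(Z has_derivative (\<lambda>q. fst q + g t * snd q)) (at (w, x0) within S)"
      unfolding Z_def[abs_def] by (auto intro!: derivative_eq_intros)
    note 3 = DERIV_compose_FDERIV[OF 1 2]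
    have "((\<lambda>q. (Q t * Z q powr - \<gamma>, Q t * Z q powr - \<gamma> * g t)) has_derivative
        (\<lambda>q. ((fst q + g t * snd q) * (- \<gamma> * Q t * Z (w, x0) powr (- \<gamma> - 1)),
              (fst q + g t * snd q) * (- \<gamma> * Q t * Z (w, x0) powr (- \<gamma> - 1)) * g t))) (at (w, x0) within S)"
      by (intro has_derivative_Pair 3 has_derivative_mult_left)
    then show ?thesis
      by (rule back_subst[where P="\<lambda>f. (f has_derivative _) _", THEN has_derivative_eq_rhs])
         (auto simp: vw_def vx_def vww_def vwx_def vxx_def Z fun_eq_iff algebra_simps power2_eq_square)
  qed
  have eq: "ereal (- vt p) = HH p (vw p, vx p) (vww p, vwx p, vxx p)" if p: "p \<in> U" for p
  proof -
    obtain t w x0 x1 where peq: "p = (t, w, x0, x1)" by (cases p)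
    show ?thesis
      using hjb[OF p[unfolded peq] Gam_eq] U_pos[OF p]
      by (simp add: peq vt_def vw_def vx_def vww_def vwx_def vxx_def)
  qed
  have "Q \<tau>R * (?G (\<tau>R, w, x) powr (1 - \<gamma>) / (1 - \<gamma>)) = vT (w, x)" if "(\<tau>R, w, x) \<in> U" for w x
  proof -
    \<comment> \<open>Both \<open>g\<close> and \<open>h\<close> vanish at retirement, so
      \<open>Gam\<close> reduces to the wealth \<open>w\<close> there.\<close>
    have "H \<tau>R = to_L2 d (\<lambda>_. 0)"
      unfolding H_def by (rule to_L2_cong) (simp add: h_after)
    also have "\<dots> = 0"
      using to_L2_scale[of d "\<lambda>_. 0" 0] sq_integrable_zero by (simp add: restr_def[abs_def])
    finally have "?G (\<tau>R, w, x) = w"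
      by (cases x) (simp add: Gam_eq g_after)
    then show ?thesis using terminal[OF that] by simp
  qed
  note term_eq = this
  show ?thesis
    unfolding classical_solution_def
  proof (rule exI[of _ vt], rule exI[of _ vw], rule exI[of _ vx], rule exI[of _ vww],
      rule exI[of _ vwx], rule exI[of _ vxx], intro conjI)
    show "\<forall>(t, w, x0, x1)\<in>U.
        ((\<lambda>(w', x0'). (vw (t, w', x0', x1), fst (vx (t, w', x0', x1)))) has_derivative
         (\<lambda>(\<omega>, \<xi>0). (vww (t, w, x0, x1) * \<omega> + vwx (t, w, x0, x1) * \<xi>0,
                      vwx (t, w, x0, x1) * \<omega> + vxx (t, w, x0, x1) * \<xi>0)))
        (at (w, x0) within {(w', x0'). (t, w', x0', x1) \<in> U})"
      using hess by blast
    show "\<forall>w x. (\<tau>R, w, x) \<in> U \<longrightarrow> Q (fst (\<tau>R, w, x)) *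
        (?G (\<tau>R, w, x) powr (1 - \<gamma>) / (1 - \<gamma>)) = vT (w, x)"
      unfolding fst_conv using term_eq by blast
  qed (use der eq dom vx_M2 in \<open>blast intro: vw_cont vt_cont vx_cont vww_cont vwx_cont vxx_cont Astar_cont\<close>)+
qed

end

section \<open>Verification of the equation for the explicit candidate\<close>

theorem proposition6p4:
  fixes r \<delta> \<rho> K k \<gamma> \<tau>R d \<mu>y \<beta> b \<nu> \<eta> \<eta>' :: real
    and \<mu> \<sigma>y \<kappa> :: "real^'n" and \<sigma> :: "real^'n^'n" and \<phi> :: L2fun
    and g f F :: "real \<Rightarrow> real" and h :: "real \<Rightarrow> real \<Rightarrow> real"
  assumes "invertible \<sigma>" and "\<delta> > 0" and "\<rho> > 0" and "K > 1" and "k > 0"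
    and "\<gamma> > 0" and "\<gamma> \<noteq> 1" and "\<tau>R > 0" and "d > 0" and "\<phi> \<in> L2 d"
    and "\<kappa> = matrix_inv \<sigma> *v (\<mu> - r *\<^sub>R (\<chi> i. 1))"
    and "\<beta> = r + \<delta> - \<mu>y + inner \<sigma>y \<kappa>" and "\<beta> > 0"
    and "gh_solution r \<delta> \<beta> d \<phi> \<tau>R g h"
    and "\<rho> + \<delta> - (1 - \<gamma>) * (r + \<delta> + inner \<kappa> \<kappa> / (2 * \<gamma>)) > 0"
    and "b = 1 - 1 / \<gamma>"
    and "\<nu> = \<gamma> / (\<rho> + \<delta> - (1 - \<gamma>) * (r + \<delta> + inner \<kappa> \<kappa> / (2 * \<gamma>)))"
    and "\<eta> = (1 + \<delta> * k powr (- b)) * \<nu>"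
    and "\<eta>' = (K powr (- b) + \<delta> * k powr (- b)) * \<nu>"
    and "\<forall>t\<in>{0..\<tau>R}. f t = (\<eta>' - \<eta>) * exp (- (\<tau>R - t) / \<nu>) + \<eta>"
    and "\<forall>t\<in>{0..\<tau>R}. F t = exp (- (\<rho> + \<delta>) * t / \<gamma>) * f t"
  shows "classical_solution d (Astar d \<mu>y \<phi>) \<tau>R (Hpp d \<tau>R g h)
           (Ham r \<mu> \<sigma> \<mu>y \<sigma>y \<delta> \<rho> k \<gamma> d \<phi>)
           (\<lambda>(w, x). exp (- (\<rho> + \<delta>) * \<tau>R) * \<eta>' powr \<gamma> * (w powr (1 - \<gamma>) / (1 - \<gamma>)))
           (\<lambda>p. F (fst p) powr \<gamma> * (Gam d g h p powr (1 - \<gamma>) / (1 - \<gamma>)))"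
proof -
  note \<sigma> = assms(1) and \<delta> = assms(2) and \<gamma> = assms(6,7)
  interpret annuity r \<delta> \<beta> d \<phi> \<tau>R g h
    using assms(8,9,10,14) by unfold_locales
  have \<kappa>: "\<sigma> *v \<kappa> = \<mu> - r *\<^sub>R (\<chi> i. 1)"
    unfolding assms(11) by (simp add: matrix_vector_mul_assoc matrix_inv_mult[OF \<sigma>])
  define m where "m = 1 + \<delta> * k powr (- b)"
  define A where "A = r + \<delta> + inner \<kappa> \<kappa> / (2 * \<gamma>)"
  have \<nu>_pos: "\<nu> > 0"
    unfolding assms(17) using assms(15) \<gamma> by simp
  have \<nu>: "1 / \<nu> = (\<rho> + \<delta> - (1 - \<gamma>) * A) / \<gamma>"
    unfolding assms(17) A_def by simp
  have \<eta>: "\<eta> = m * \<nu>"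
    by (simp add: assms(18) m_def)
  have "m > 0" "\<eta> > 0" "\<eta>' > 0"
    unfolding \<eta> assms(19) m_def using \<delta> \<nu>_pos assms(4,5) by (auto intro!: mult_pos_pos add_pos_pos)
  have f_pos: "f t > 0" if "t \<in> {0..\<tau>R}" for t
  proof -
    \<comment> \<open>Regrouping writes \<open>f t\<close> as a convex combination of the positive
      numbers \<open>\<eta>'\<close> and \<open>\<eta>\<close>, with weight \<open>?e\<close> at
      most 1.\<close>
    let ?e = "exp (- (\<tau>R - t) / \<nu>)"
    have "?e \<le> 1" using that \<nu>_pos by (simp add: divide_nonpos_pos)
    then have "0 < \<eta>' * ?e + \<eta> * (1 - ?e)"
      using \<open>\<eta> > 0\<close> \<open>\<eta>' > 0\<close> by (intro add_pos_nonneg mult_nonneg_nonneg) auto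
    also have "\<dots> = f t" using assms(20) that by (simp add: algebra_simps)
    finally show ?thesis .
  qed
  have F: "F t = exp (- (\<rho> + \<delta>) * t / \<gamma>) * f t" if "t \<in> {0..\<tau>R}" for t
    using assms(21) that by blast
  have F_pos: "F t > 0" if "t \<in> {0..\<tau>R}" for t
    using F[OF that] f_pos[OF that] by simp
  \<comment> \<open>This is the logarithmic derivative of \<open>F\<close>, obtained from
    \<open>f' = f / \<nu> - m\<close> and the exponential factor; hence
    \<open>F powr \<gamma>\<close> has derivative
    \<open>\<gamma> * F powr \<gamma> * l\<close>.\<close>
  define l where "l t = 1 / \<nu> - m / f t - (\<rho> + \<delta>) / \<gamma>" for t
  have f_der: "(f has_real_derivative (f t - \<eta>) / \<nu>) (at t within {0..\<tau>R})" if t: "t \<in> {0..\<tau>R}" for t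
  proof -
    have "((\<lambda>t. (\<eta>' - \<eta>) * exp (- (\<tau>R - t) / \<nu>) + \<eta>) has_real_derivative (f t - \<eta>) / \<nu>)
        (at t within {0..\<tau>R})"
      using \<nu>_pos assms(20) t by (auto intro!: derivative_eq_intros)
    then show ?thesis
      by (rule has_field_derivative_transform_within[where d=1]) (use t assms(20) in auto)
  qed
  have F_der: "(F has_real_derivative F t * l t) (at t within {0..\<tau>R})" if t: "t \<in> {0..\<tau>R}" for t
  proof -
    have "((\<lambda>t. exp (- (\<rho> + \<delta>) * t / \<gamma>)) has_real_derivative
        exp (- (\<rho> + \<delta>) * t / \<gamma>) * (- (\<rho> + \<delta>) / \<gamma>)) (at t within {0..\<tau>R})"
      using \<gamma> by (auto intro!: derivative_eq_intros)
    from DERIV_mult[OF this f_der[OF t]]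
    have "((\<lambda>t. exp (- (\<rho> + \<delta>) * t / \<gamma>) * f t) has_real_derivative F t * l t) (at t within {0..\<tau>R})"
      by (rule DERIV_cong)
         (use f_pos[OF t] \<nu>_pos \<gamma> in \<open>simp add: F[OF t] l_def \<eta> field_simps\<close>)
    then show ?thesis
      by (rule has_field_derivative_transform_within[where d=1]) (use t F in auto)
  qed
  have l_cont: "continuous_on {0..\<tau>R} l"
    unfolding l_def[abs_def] using f_pos f_der
    by (intro continuous_intros DERIV_continuous_on) force+
  show ?thesis
  proof (rule classical_solutionI[where Q="\<lambda>t. F t powr \<gamma>" and Q'="\<lambda>t. \<gamma> * F t powr \<gamma> * l t"])
    show "((\<lambda>t. F t powr \<gamma>) has_real_derivative \<gamma> * F t powr \<gamma> * l t) (at t within {0..\<tau>R})"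
      if t: "t \<in> {0..\<tau>R}" for t
    proof -
      have "F t powr (\<gamma> - 1) * F t = F t powr \<gamma>"
        using F_pos[OF t] by (simp add: powr_mult_base mult.commute)
      then show ?thesis
        using DERIV_chain2[OF has_real_derivative_powr[OF F_pos[OF t]] F_der[OF t], of \<gamma>]
        by (simp add: mult.assoc) (simp flip: mult.assoc)
    qed
    show "continuous_on {0..\<tau>R} (\<lambda>t. \<gamma> * F t powr \<gamma> * l t)"
      using F_pos F_der by (intro continuous_intros l_cont DERIV_continuous_on) force+
  next
    fix w :: real and x :: "real \<times> L2fun"
    have "F \<tau>R = exp (- (\<rho> + \<delta>) * \<tau>R / \<gamma>) * \<eta>'"
      using F[of \<tau>R] assms(20) \<tau>R_pos by simp
    then have "F \<tau>R powr \<gamma> = exp (- (\<rho> + \<delta>) * \<tau>R) * \<eta>' powr \<gamma>"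
      using \<gamma> \<open>\<eta>' > 0\<close> by (simp add: powr_mult exp_powr_real)
    then show "F \<tau>R powr \<gamma> * (w powr (1 - \<gamma>) / (1 - \<gamma>))
      = (case (w, x) of (w, x) \<Rightarrow> exp (- (\<rho> + \<delta>) * \<tau>R) * \<eta>' powr \<gamma> * (w powr (1 - \<gamma>) / (1 - \<gamma>)))"
      by simp
  next
    fix t w x0 x1 G
    assume U: "(t, w, x0, x1) \<in> U" and G: "G = w + g t * x0 + inner (H t) x1" and G_pos: "0 < G"
    have t: "t \<in> {0..\<tau>R}" using U_fst[OF U] by simp
    define p0 where "p0 = F t powr \<gamma> * G powr - \<gamma>"
    have p0_pos: "p0 > 0" using F_pos[OF t] G_pos by (simp add: p0_def)
    define P11 where "P11 = - \<gamma> * F t powr \<gamma> * G powr (- \<gamma> - 1)"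
    have P11: "P11 = - \<gamma> * p0 / G"
      using G_pos by (simp add: P11_def p0_def powr_diff)
    have P11_neg: "P11 < 0" using P11 \<gamma> p0_pos G_pos by simp
    \<comment> \<open>Since \<open>F\<close> is \<open>f\<close> times the discount factor raised to
      \<open>1 / \<gamma>\<close>, solving the first-order condition for consumption gives
      \<open>G / f t\<close>. The extra weight on bequest rescales this by
      \<open>k powr - b\<close>.\<close>
    define c0 where "c0 = G / f t"
    define B0 where "B0 = k powr - b * c0"
    have c0_pos: "c0 > 0" using G_pos f_pos[OF t] by (simp add: c0_def)
    have B0_pos: "B0 > 0" using c0_pos assms(5) by (simp add: B0_def)
    have c0: "exp (- (\<rho> + \<delta>) * t) * c0 powr - \<gamma> = p0"
      using F[OF t] \<gamma> f_pos[OF t] G_pos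
      by (simp add: c0_def p0_def powr_mult exp_powr_real powr_divide powr_minus divide_simps)
    \<comment> \<open>The exponents cancel because
      \<open>\<gamma> * b = \<gamma> - 1\<close>.\<close>
    have "k powr (1 - \<gamma>) * (k powr - b) powr - \<gamma> = 1"
      using \<gamma> assms(5) by (simp add: powr_powr assms(16) left_diff_distrib flip: powr_add)
    then have "k powr (1 - \<gamma>) * B0 powr - \<gamma> = c0 powr - \<gamma>"
      using c0_pos by (simp add: B0_def powr_mult flip: mult.assoc)
    with c0 have B0: "exp (- (\<rho> + \<delta>) * t) * (k powr (1 - \<gamma>) * B0 powr - \<gamma>) = p0"
      by simp
    define q where "q = p0 *\<^sub>R \<kappa> + (x0 * (P11 * g t)) *\<^sub>R \<sigma>y"
    note Ham_max = Ham_max_eq[OF \<sigma> \<kappa> \<delta> \<gamma> P11_neg c0_pos c0 B0_pos B0,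
      where ?x0.0=x0 and ?P12.0="P11 * g t" and \<sigma>y=\<sigma>y, folded q_def]
    \<comment> \<open>Of the three terms, the first gives the risk premium, the cross term supplies
      the part \<open>inner \<sigma>y \<kappa>\<close> of \<open>\<beta>\<close>, and the last is
      cancelled by the second-order income term of the Hamiltonian.\<close>
    have "inner q q / (2 * P11) = p0\<^sup>2 * inner \<kappa> \<kappa> / (2 * P11) + p0 * x0 * g t * inner \<sigma>y \<kappa>
        + 1 / 2 * inner \<sigma>y \<sigma>y * x0\<^sup>2 * (P11 * (g t)\<^sup>2)"
      using P11_neg by (simp add: q_def inner_simps inner_commute field_simps power2_eq_square)
    also have "p0\<^sup>2 * inner \<kappa> \<kappa> / (2 * P11) = - p0 * G * inner \<kappa> \<kappa> / (2 * \<gamma>)"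
      unfolding P11 using \<gamma> p0_pos G_pos by (simp add: field_simps power2_eq_square)
    finally have risk: "inner q q / (2 * P11) = - p0 * G * inner \<kappa> \<kappa> / (2 * \<gamma>) + p0 * x0 * g t * inner \<sigma>y \<kappa>
        + 1 / 2 * inner \<sigma>y \<sigma>y * x0\<^sup>2 * (P11 * (g t)\<^sup>2)" .
    have consumption: "c0 + \<delta> * B0 = m * (G / f t)"
      by (simp add: c0_def B0_def m_def algebra_simps)
    have "\<gamma> * F t powr \<gamma> * l t * (G powr (1 - \<gamma>) / (1 - \<gamma>)) = p0 * (G * (\<gamma> / (1 - \<gamma>) * l t))"
      using powr_mult_base[of G "- \<gamma>"] G_pos by (simp add: p0_def ac_simps)
    \<comment> \<open>Inserting \<open>1 / \<nu>\<close> removes \<open>\<rho> + \<delta>\<close>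
      from \<open>l t\<close>; what is left is
      \<open>- (1 - \<gamma>) * A / \<gamma> - m / f t\<close>.\<close>
    also have "\<gamma> / (1 - \<gamma>) * l t = - A - \<gamma> / (1 - \<gamma>) * (m / f t)"
      unfolding l_def \<nu> using \<gamma> f_pos[OF t] by (simp add: divide_simps) (simp add: algebra_simps)
    finally have time: "\<gamma> * F t powr \<gamma> * l t * (G powr (1 - \<gamma>) / (1 - \<gamma>))
        = - p0 * G * A - \<gamma> / (1 - \<gamma>) * p0 * (m * (G / f t))"
      by (simp add: algebra_simps)
    have drift: "inner (x0, x1) (Astar d \<mu>y \<phi> (p0 *\<^sub>R (g t, H t)))
        = p0 * (x0 * (\<mu>y * g t + h t 0) + (r + \<delta>) * inner (H t) x1 - inner (dH t) x1)"
      unfolding grad_dom_Astar(2)[OF t]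
      by (simp add: inner_diff_right inner_commute algebra_simps)
    \<comment> \<open>After the terms in \<open>dH t\<close> and \<open>h t 0\<close> cancel, the
      multiples of \<open>g t * x0\<close> match precisely because
      \<open>r + \<delta> - \<beta> = \<mu>y - inner \<sigma>y \<kappa>\<close>.\<close>
    have "- (\<gamma> * F t powr \<gamma> * l t * (G powr (1 - \<gamma>) / (1 - \<gamma>)) + p0 * (dg t * x0 + inner (dH t) x1))
      = ((r + \<delta>) * w * p0 + x0 * p0 + inner (x0, x1) (Astar d \<mu>y \<phi> (p0 *\<^sub>R (g t, H t)))
          + 1 / 2 * inner \<sigma>y \<sigma>y * x0\<^sup>2 * (P11 * (g t)\<^sup>2))
        + (\<gamma> / (1 - \<gamma>) * p0 * (c0 + \<delta> * B0) - inner q q / (2 * P11))"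
      unfolding time drift risk consumption
      unfolding A_def dg_def
      unfolding assms(12) by (simp add: G algebra_simps add_divide_distrib diff_divide_distrib)
    then show "ereal (- (\<gamma> * F t powr \<gamma> * l t * (G powr (1 - \<gamma>) / (1 - \<gamma>))
          + F t powr \<gamma> * G powr - \<gamma> * (dg t * x0 + inner (dH t) x1)))
      = Ham r \<mu> \<sigma> \<mu>y \<sigma>y \<delta> \<rho> k \<gamma> d \<phi> (t, w, x0, x1)
          (F t powr \<gamma> * G powr - \<gamma>, (F t powr \<gamma> * G powr - \<gamma>) *\<^sub>R (g t, H t))
          (- \<gamma> * F t powr \<gamma> * G powr (- \<gamma> - 1), - \<gamma> * F t powr \<gamma> * G powr (- \<gamma> - 1) * g t,
           - \<gamma> * F t powr \<gamma> * G powr (- \<gamma> - 1) * (g t)\<^sup>2)"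
      unfolding p0_def[symmetric] P11_def[symmetric] Ham_def prod.case fst_conv Ham_max
      by (simp only: plus_ereal.simps)
  qed (use \<gamma> in auto)
qed

end
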